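(* Let $n\ge 2$. In the localization $(\widehat{\mathcal{H}}_n^-)_\delta$ define, for $1\le i\le n-1$, $$\gimel_i = R_i -\varepsilon\, (p_i-p_{i+1})^{-1}(q_i -q_{i+1}).$$ These elements satisfy the following relations (for all indices for which the expressions make sense): $$\gimel_i^2 = -2 + 2\varepsilon^2 \,(p_i -p_{i+1})^{-2}(p_i p_{i+1} -1),$$ $$\gimel_i \gimel_{i+1} \gimel_i = \gimel_{i+1} \gimel_i \gimel_{i+1},\qquad \gimel_i\gimel_j = - \gimel_j \gimel_i \quad (|i-j|>1),$$ $$\gimel_i p_i = p_{i+1} \gimel_i,\qquad \gimel_i p_{i+1} = p_{i} \gimel_i,$$ $$\gimel_i p_j =p_j \gimel_i,\qquad \gimel_i q_j = -q_j \gimel_i \quad (j \neq i,i+1),$$ $$\gimel_i q_i = -q_{i+1} \gimel_i,\qquad \gimel_i q_{i+1} = -q_{i} \gimel_i.$$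
   Context: Let $q$ be a formal parameter and $\varepsilon=q-q^{-1}$ (the parameter $q$ is not to be confused with the generators $q_i$). The spin affine Hecke algebra $\widehat{\mathcal{H}}_n^-$ is the unital associative $\mathbb{C}(q)$-algebra generated by $R_i$ $(1\le i\le n-1)$ and $p_i,q_i$ $(1\le i\le n)$ subject to: $R_i^2=-\varepsilon^2-2$; $R_iR_j=-R_jR_i$ for $|i-j|>1$; $R_iR_{i+1}R_i-R_{i+1}R_iR_{i+1}=\varepsilon^2(R_{i+1}-R_i)$; $p_ip_j=p_jp_i$ and $q_iq_j=-q_jq_i$ for $i\ne j$; $p_i^2+q_i^2=1$; $p_iq_j=q_jp_i$ for all $i,j$; $R_ip_j=p_jR_i$ and $R_iq_j=-q_jR_i$ for $j\ne i,i+1$; $R_ip_i=p_{i+1}R_i+\varepsilon(q_i-q_{i+1})$; $R_iq_i=-q_{i+1}R_i-\varepsilon(p_i+p_{i+1})$. The element $\delta:=\prod_{1\le i<j\le n}(p_i-p_j)^2$ is central in $\widehat{\mathcal{H}}_n^-$, and $(\widehat{\mathcal{H}}_n^-)_\delta$ denotes the localization of $\widehat{\mathcal{H}}_n^-$ at $\delta$ (inverting the powers of $\delta$); in particular $p_i-p_{i+1}$ is invertible there. *)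

theory Defs
  imports
    "HOL-Algebra.QuotRing"
    "HOL-Library.Poly_Mapping"
    "HOL-Computational_Algebra.Polynomial"
    "HOL-Computational_Algebra.Fraction_Field"
begin

section \<open>The ground field\<close>

type_synonym cq = "complex poly fract"

definition qpar :: cq where
  "qpar = Fract [:0, 1:] 1"

definition eps :: cq where
  "eps = qpar - inverse qpar"


section \<open>The free algebra\<close>

datatype gen = GR nat | GP nat | GQ nat

text \<open>Words are wrapped in a type of their own so that concatenation can be the addition
  that the convolution product of \<^type>\<open>poly_mapping\<close> uses.\<close>

datatype word = Word (letters: "gen list")

instantiation word :: monoid_add
begin

definition zero_word :: word where
  "zero_word = Word []"

definition plus_word :: "word \<Rightarrow> word \<Rightarrow> word" where
  "plus_word u v = Word (letters u @ letters v)"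

instance
  by standard (simp_all add: zero_word_def plus_word_def)

end

type_synonym free = "word \<Rightarrow>\<^sub>0 cq"

definition scalF :: "cq \<Rightarrow> free" where
  "scalF c = Poly_Mapping.single 0 c"

definition genF :: "gen \<Rightarrow> free" where
  "genF g = Poly_Mapping.single (Word [g]) 1"

abbreviation RF :: "nat \<Rightarrow> free" where "RF i \<equiv> genF (GR i)"
abbreviation pF :: "nat \<Rightarrow> free" where "pF i \<equiv> genF (GP i)"
abbreviation qF :: "nat \<Rightarrow> free" where "qF i \<equiv> genF (GQ i)"

definition gens :: "nat \<Rightarrow> gen set" where
  "gens n = GR ` {1..<n} \<union> GP ` {1..n} \<union> GQ ` {1..n}"

text \<open>The type \<^typ>\<open>free\<close> has generators for all indices; the carrier keeps those that
  exist for the given \<open>n\<close>.\<close>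

definition free_alg :: "nat \<Rightarrow> free ring" where
  "free_alg n = \<lparr>carrier = {f. \<forall>w \<in> Poly_Mapping.keys f. set (letters w) \<subseteq> gens n},
     monoid.mult = (*), one = 1, zero = 0, add = (+)\<rparr>"

lemma keys_mult_word: "w \<in> Poly_Mapping.keys (f * g) \<Longrightarrow> \<exists>u\<in>Poly_Mapping.keys f. \<exists>v\<in>Poly_Mapping.keys g. w = u + v"
  for f g :: free
  using keys_mult[of f g] by blast

lemma free_alg_ring: "ring (free_alg n)"
proof (rule ringI)
  have minus: "\<exists>y\<in>carrier (free_alg n). y \<oplus>\<^bsub>free_alg n\<^esub> x = \<zero>\<^bsub>free_alg n\<^esub>"
    if "x \<in> carrier (free_alg n)" for x
    by (rule bexI[of _ "- x"]) (use that in \<open>auto simp: free_alg_def\<close>)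
  show "abelian_group (free_alg n)"
    by (rule abelian_groupI)
       (use minus in \<open>auto simp: free_alg_def add.assoc add.commute dest!: set_mp[OF Poly_Mapping.keys_add]\<close>)
  show "Group.monoid (free_alg n)"
    by (rule monoidI) (fastforce simp: free_alg_def mult.assoc zero_word_def plus_word_def
        dest!: keys_mult_word split: if_splits)+
qed (simp_all add: free_alg_def algebra_simps)

lemma genF_closed: "g \<in> gens n \<Longrightarrow> genF g \<in> carrier (free_alg n)"
  by (simp add: free_alg_def genF_def)

lemma scalF_closed: "scalF c \<in> carrier (free_alg n)"
  by (simp add: free_alg_def scalF_def zero_word_def)

lemma free_alg_closed:
  shows "\<lbrakk>x \<in> carrier (free_alg n); y \<in> carrier (free_alg n)\<rbrakk> \<Longrightarrow> x + y \<in> carrier (free_alg n)"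
    and "\<lbrakk>x \<in> carrier (free_alg n); y \<in> carrier (free_alg n)\<rbrakk> \<Longrightarrow> x * y \<in> carrier (free_alg n)"
    and "x \<in> carrier (free_alg n) \<Longrightarrow> - x \<in> carrier (free_alg n)"
    and "\<lbrakk>x \<in> carrier (free_alg n); y \<in> carrier (free_alg n)\<rbrakk> \<Longrightarrow> x - y \<in> carrier (free_alg n)"
proof -
  interpret ring "free_alg n" by (rule free_alg_ring)
  have minus: "- z \<in> carrier (free_alg n)" if "z \<in> carrier (free_alg n)" for z
    using that by (simp add: free_alg_def)
  then show "x \<in> carrier (free_alg n) \<Longrightarrow> - x \<in> carrier (free_alg n)" .
  assume x: "x \<in> carrier (free_alg n)" and y: "y \<in> carrier (free_alg n)"
  show "x + y \<in> carrier (free_alg n)" "x * y \<in> carrier (free_alg n)"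
    using a_closed[OF x y] m_closed[OF x y] by (simp_all add: free_alg_def)
  show "x - y \<in> carrier (free_alg n)"
    using a_closed[OF x minus[OF y]] by (simp add: free_alg_def)
qed

lemma one_closed: "1 \<in> carrier (free_alg n)"
  using scalF_closed[of 1 n] by (simp add: scalF_def)


section \<open>The spin affine Hecke algebra\<close>

inductive hecke_rel :: "nat \<Rightarrow> free \<Rightarrow> free \<Rightarrow> bool" for n :: nat where
  R_sq: "i \<in> {1..<n} \<Longrightarrow> hecke_rel n (RF i * RF i) (scalF (- eps\<^sup>2 - 2))"
| R_R: "\<lbrakk>i \<in> {1..<n}; j \<in> {1..<n}; \<bar>int i - int j\<bar> > 1\<rbrakk>
    \<Longrightarrow> hecke_rel n (RF i * RF j) (- (RF j * RF i))"
| R_braid: "\<lbrakk>i \<in> {1..<n}; i + 1 \<in> {1..<n}\<rbrakk>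
    \<Longrightarrow> hecke_rel n (RF i * RF (i+1) * RF i - RF (i+1) * RF i * RF (i+1))
          (scalF (eps\<^sup>2) * (RF (i+1) - RF i))"
| p_p: "\<lbrakk>i \<in> {1..n}; j \<in> {1..n}; i \<noteq> j\<rbrakk> \<Longrightarrow> hecke_rel n (pF i * pF j) (pF j * pF i)"
| q_q: "\<lbrakk>i \<in> {1..n}; j \<in> {1..n}; i \<noteq> j\<rbrakk> \<Longrightarrow> hecke_rel n (qF i * qF j) (- (qF j * qF i))"
| p_q_sq: "i \<in> {1..n} \<Longrightarrow> hecke_rel n (pF i * pF i + qF i * qF i) 1"
| p_q: "\<lbrakk>i \<in> {1..n}; j \<in> {1..n}\<rbrakk> \<Longrightarrow> hecke_rel n (pF i * qF j) (qF j * pF i)"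
| R_p_far: "\<lbrakk>i \<in> {1..<n}; j \<in> {1..n}; j \<noteq> i; j \<noteq> i + 1\<rbrakk>
    \<Longrightarrow> hecke_rel n (RF i * pF j) (pF j * RF i)"
| R_q_far: "\<lbrakk>i \<in> {1..<n}; j \<in> {1..n}; j \<noteq> i; j \<noteq> i + 1\<rbrakk>
    \<Longrightarrow> hecke_rel n (RF i * qF j) (- (qF j * RF i))"
| R_p: "i \<in> {1..<n}
    \<Longrightarrow> hecke_rel n (RF i * pF i) (pF (i+1) * RF i + scalF eps * (qF i - qF (i+1)))"
| R_q: "i \<in> {1..<n}
    \<Longrightarrow> hecke_rel n (RF i * qF i) (- (qF (i+1) * RF i) - scalF eps * (pF i + pF (i+1)))"

lemma hecke_rel_closed:
  "hecke_rel n a b \<Longrightarrow> a - b \<in> carrier (free_alg n)"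
  by (induction rule: hecke_rel.induct)
     (intro free_alg_closed genF_closed scalF_closed one_closed; auto simp: gens_def)+

definition hecke_ideal :: "nat \<Rightarrow> free set" where
  "hecke_ideal n = genideal (free_alg n) {a - b |a b. hecke_rel n a b}"

lemma hecke_ideal_ideal: "ideal (hecke_ideal n) (free_alg n)"
  unfolding hecke_ideal_def
  by (rule ring.genideal_ideal[OF free_alg_ring]) (auto intro: hecke_rel_closed)

definition spin_hecke :: "nat \<Rightarrow> free set ring" where
  "spin_hecke n = free_alg n Quot hecke_ideal n"

lemma spin_hecke_ring: "ring (spin_hecke n)"
  unfolding spin_hecke_def by (rule ideal.quotient_is_ring[OF hecke_ideal_ideal])

definition hecke_class :: "nat \<Rightarrow> free \<Rightarrow> free set" where
  "hecke_class n x = hecke_ideal n +>\<^bsub>free_alg n\<^esub> x"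

text \<open>The product is written as a product over a list only because the free algebra is not
  commutative; the \<open>p\<^sub>i\<close> commute in the quotient, so the order of the factors is immaterial.\<close>

definition hecke_delta :: "nat \<Rightarrow> free set" where
  "hecke_delta n = hecke_class n
     (prod_list [(pF i - pF j)\<^sup>2. i \<leftarrow> [1..<n+1], j \<leftarrow> [i+1..<n+1]])"


section \<open>Localization at a central element\<close>

text \<open>The pair \<open>(a, k)\<close> stands for the fraction \<open>d\<^sup>-\<^sup>k a\<close>.  The construction is meant for
  \<open>d\<close> central in the (possibly noncommutative) ring \<open>A\<close>; \<open>d\<close> may be a zero divisor.\<close>

definition frac_rel :: "('a, 'm) ring_scheme \<Rightarrow> 'a \<Rightarrow> (('a \<times> nat) \<times> ('a \<times> nat)) set" where
  "frac_rel A d = {((a, k), (b, l)). a \<in> carrier A \<and> b \<in> carrier A \<and>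
     (\<exists>m. (d [^]\<^bsub>A\<^esub> (m::nat)) \<otimes>\<^bsub>A\<^esub> ((d [^]\<^bsub>A\<^esub> l) \<otimes>\<^bsub>A\<^esub> a)
        = (d [^]\<^bsub>A\<^esub> m) \<otimes>\<^bsub>A\<^esub> ((d [^]\<^bsub>A\<^esub> k) \<otimes>\<^bsub>A\<^esub> b))}"

definition fraction :: "('a, 'm) ring_scheme \<Rightarrow> 'a \<Rightarrow> 'a \<Rightarrow> nat \<Rightarrow> ('a \<times> nat) set" where
  "fraction A d a k = frac_rel A d `` {(a, k)}"

definition localization :: "('a, 'm) ring_scheme \<Rightarrow> 'a \<Rightarrow> ('a \<times> nat) set ring" where
  "localization A d =
     \<lparr>carrier = (carrier A \<times> UNIV) // frac_rel A d,
      monoid.mult = (\<lambda>X Y. \<Union>(a, k)\<in>X. \<Union>(b, l)\<in>Y. fraction A d (a \<otimes>\<^bsub>A\<^esub> b) (k + l)),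
      one = fraction A d \<one>\<^bsub>A\<^esub> 0,
      zero = fraction A d \<zero>\<^bsub>A\<^esub> 0,
      add = (\<lambda>X Y. \<Union>(a, k)\<in>X. \<Union>(b, l)\<in>Y.
        fraction A d ((d [^]\<^bsub>A\<^esub> l) \<otimes>\<^bsub>A\<^esub> a \<oplus>\<^bsub>A\<^esub> (d [^]\<^bsub>A\<^esub> k) \<otimes>\<^bsub>A\<^esub> b) (k + l))\<rparr>"

locale central_element = ring A for A (structure) +
  fixes d
  assumes d_closed [simp, intro]: "d \<in> carrier A"
    and d_central: "\<And>x. x \<in> carrier A \<Longrightarrow> x \<otimes> d = d \<otimes> x"
begin

lemma pow_central: "x \<in> carrier A \<Longrightarrow> x \<otimes> (d [^] (k::nat)) = (d [^] k) \<otimes> x"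
proof (induction k)
  case (Suc k)
  have "x \<otimes> (d [^] k \<otimes> d) = (x \<otimes> d [^] k) \<otimes> d" using Suc.prems by (simp add: m_assoc)
  also have "\<dots> = d [^] k \<otimes> (x \<otimes> d)" using Suc by (simp add: m_assoc)
  also have "\<dots> = d [^] k \<otimes> d \<otimes> x" using Suc.prems by (simp add: d_central[OF Suc.prems] m_assoc)
  finally show ?case by simp
qed simp

lemma pow_lcomm: "x \<in> carrier A \<Longrightarrow> y \<in> carrier A \<Longrightarrow>
   x \<otimes> ((d [^] (k::nat)) \<otimes> y) = (d [^] k) \<otimes> (x \<otimes> y)"
  by (metis pow_central m_assoc nat_pow_closed d_closed)

lemma pow_pow: "y \<in> carrier A \<Longrightarrow> (d [^] (k::nat)) \<otimes> ((d [^] (l::nat)) \<otimes> y) = (d [^] (k+l)) \<otimes> y"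
  by (metis m_assoc nat_pow_closed d_closed nat_pow_mult)

lemma rel_iff: "((a,k),(b,l)) \<in> frac_rel A d \<longleftrightarrow> a \<in> carrier A \<and> b \<in> carrier A \<and>
   (\<exists>m::nat. (d [^] (m+l)) \<otimes> a = (d [^] (m+k)) \<otimes> b)"
  by (auto simp: frac_rel_def pow_pow)

lemma scale: "a \<in> carrier A \<Longrightarrow> b \<in> carrier A \<Longrightarrow> (d [^] (i::nat)) \<otimes> a = (d [^] (j::nat)) \<otimes> b \<Longrightarrow>
   (d [^] (t+i)) \<otimes> a = (d [^] (t+j)) \<otimes> b"
  by (metis pow_pow)

lemma rel_equiv: "equiv (carrier A \<times> UNIV) (frac_rel A d)"
proof (rule equivI)
  show "frac_rel A d \<subseteq> (carrier A \<times> UNIV) \<times> (carrier A \<times> UNIV)" by (auto simp: frac_rel_def)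
  show "refl_on (carrier A \<times> UNIV) (frac_rel A d)"
    by (auto simp: refl_on_def rel_iff) 
  show "sym (frac_rel A d)" unfolding sym_def by (auto simp: rel_iff) (metis)
  show "trans (frac_rel A d)"
  proof (rule transI, clarify)
    fix a k b l c r assume 1: "((a,k),(b,l)) \<in> frac_rel A d" and 2: "((b,l),(c,r)) \<in> frac_rel A d"
    from 1 2 obtain m m' where *: "a \<in> carrier A" "b \<in> carrier A" "c \<in> carrier A"
      "(d [^] (m+l)) \<otimes> a = (d [^] (m+k)) \<otimes> b" "(d [^] (m'+r)) \<otimes> b = (d [^] (m'+l)) \<otimes> c"
      by (auto simp: rel_iff)
    have "(d [^] (m+m'+l+r)) \<otimes> a = (d [^] (m+m'+l+k)) \<otimes> c"
      using scale[OF *(1,2,4), of "m'+r"] scale[OF *(2,3,5), of "m+k"] by (simp add: ac_simps)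
    then show "((a,k),(c,r)) \<in> frac_rel A d" using * by (auto simp: rel_iff)
  qed
qed

lemma fraction_eq: "a \<in> carrier A \<Longrightarrow> b \<in> carrier A \<Longrightarrow> fraction A d a k = fraction A d b l \<longleftrightarrow>
   (\<exists>m::nat. (d [^] (m+l)) \<otimes> a = (d [^] (m+k)) \<otimes> b)"
  unfolding fraction_def using eq_equiv_class_iff[OF rel_equiv, of "(a,k)" "(b,l)"]
  by (simp add: rel_iff)

lemma fraction_expand:
  "a \<in> carrier A \<Longrightarrow> fraction A d a k = fraction A d ((d [^] (r::nat)) \<otimes> a) (r + k)"
  by (simp add: fraction_eq pow_pow add.assoc add.commute[of k])

lemma fraction_mult: "a \<in> carrier A \<Longrightarrow> b \<in> carrier A \<Longrightarrow>
   fraction A d a k \<otimes>\<^bsub>localization A d\<^esub> fraction A d b l = fraction A d (a \<otimes> b) (k+l)"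
proof -
  assume ab: "a \<in> carrier A" "b \<in> carrier A"
  have "(\<lambda>p q. case p of (a,k) \<Rightarrow> case q of (b,l) \<Rightarrow> fraction A d (a \<otimes> b) (k+l)) respects2 frac_rel A d"
  proof (rule congruent2I'; clarify)
    fix a k a' k' b l b' l' assume "((a,k),(a',k')) \<in> frac_rel A d" "((b,l),(b',l')) \<in> frac_rel A d"
    then obtain m m' where *: "a \<in> carrier A" "b \<in> carrier A" "a' \<in> carrier A" "b' \<in> carrier A"
      "(d [^] (m+k')) \<otimes> a = (d [^] (m+k)) \<otimes> a'" "(d [^] (m'+l')) \<otimes> b = (d [^] (m'+l)) \<otimes> b'"
      by (auto simp: rel_iff)
    have "((d [^] (m+k')) \<otimes> a) \<otimes> ((d [^] (m'+l')) \<otimes> b) = ((d [^] (m+k)) \<otimes> a') \<otimes> ((d [^] (m'+l)) \<otimes> b')"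
      using * by simp
    then have "(d [^] (m+m' + (k'+l'))) \<otimes> (a \<otimes> b) = (d [^] (m+m' + (k+l))) \<otimes> (a' \<otimes> b')"
      using * by (simp add: m_assoc pow_lcomm[of a] pow_lcomm[of a'] pow_pow ac_simps)
    then show "fraction A d (a \<otimes> b) (k+l) = fraction A d (a' \<otimes> b') (k'+l')"
      using * by (subst fraction_eq) (auto)
  qed
  from UN_equiv_class2[OF rel_equiv rel_equiv this, of "(a,k)" "(b,l)"] ab
  show ?thesis by (simp add: localization_def fraction_def[symmetric] case_prod_unfold)
qed

lemma fraction_add: "a \<in> carrier A \<Longrightarrow> b \<in> carrier A \<Longrightarrow>
   fraction A d a k \<oplus>\<^bsub>localization A d\<^esub> fraction A d b l =
   fraction A d ((d [^] l) \<otimes> a \<oplus> (d [^] k) \<otimes> b) (k+l)"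
proof -
  assume ab: "a \<in> carrier A" "b \<in> carrier A"
  have "(\<lambda>p q. case p of (a,k) \<Rightarrow> case q of (b,l) \<Rightarrow> fraction A d ((d [^] l) \<otimes> a \<oplus> (d [^] k) \<otimes> b) (k+l)) respects2 frac_rel A d"
  proof (rule congruent2I'; clarify)
    fix a k a' k' b l b' l' assume "((a,k),(a',k')) \<in> frac_rel A d" "((b,l),(b',l')) \<in> frac_rel A d"
    then obtain m m' where *: "a \<in> carrier A" "b \<in> carrier A" "a' \<in> carrier A" "b' \<in> carrier A"
      "(d [^] (m+k')) \<otimes> a = (d [^] (m+k)) \<otimes> a'" "(d [^] (m'+l')) \<otimes> b = (d [^] (m'+l)) \<otimes> b'"
      by (auto simp: rel_iff)
    have "(d [^] (m+m' + (k'+l'))) \<otimes> ((d [^] l) \<otimes> a \<oplus> (d [^] k) \<otimes> b)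
       = (d [^] (m+m' + (k+l))) \<otimes> ((d [^] l') \<otimes> a' \<oplus> (d [^] k') \<otimes> b')"
      using scale[OF *(1,3,5), of "m'+l+l'"] scale[OF *(2,4,6), of "m+k+k'"] *
      by (simp add: r_distr pow_pow ac_simps)
    then show "fraction A d ((d [^] l) \<otimes> a \<oplus> (d [^] k) \<otimes> b) (k+l) = fraction A d ((d [^] l') \<otimes> a' \<oplus> (d [^] k') \<otimes> b') (k'+l')"
      using * by (subst fraction_eq) (auto)
  qed
  from UN_equiv_class2[OF rel_equiv rel_equiv this, of "(a,k)" "(b,l)"] ab
  show ?thesis by (simp add: localization_def fraction_def[symmetric] case_prod_unfold)
qed

lemma carrier_loc: "carrier (localization A d) = {fraction A d a k |a k. a \<in> carrier A}"
  by (auto simp: localization_def quotient_def fraction_def)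

lemma one_loc: "\<one>\<^bsub>localization A d\<^esub> = fraction A d \<one> 0"
  by (simp add: localization_def)

lemma loc_ring: "ring (localization A d)"
proof -
  let ?L = "localization A d"
  have z: "\<zero>\<^bsub>?L\<^esub> = fraction A d \<zero> 0" and o: "\<one>\<^bsub>?L\<^esub> = fraction A d \<one> 0"
    by (simp_all add: localization_def)
  have neg: "\<exists>y\<in>carrier ?L. y \<oplus>\<^bsub>?L\<^esub> x = \<zero>\<^bsub>?L\<^esub>" if "x \<in> carrier ?L" for x
  proof -
    from that obtain a k where a: "x = fraction A d a k" "a \<in> carrier A" by (auto simp: carrier_loc)
    have "fraction A d (\<ominus> a) k \<oplus>\<^bsub>?L\<^esub> x = \<zero>\<^bsub>?L\<^esub>" 
      using a by (simp add: fraction_add z fraction_eq r_distr pow_pow r_minus l_neg)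
    moreover have "fraction A d (\<ominus> a) k \<in> carrier ?L" using a by (auto simp: carrier_loc)
    ultimately show ?thesis by blast
  qed
  show ?thesis
  proof (rule ringI)
    show "abelian_group ?L"
    proof (rule abelian_groupI)
      fix x y assume "x \<in> carrier ?L" "y \<in> carrier ?L"
      then show "x \<oplus>\<^bsub>?L\<^esub> y \<in> carrier ?L" "x \<oplus>\<^bsub>?L\<^esub> y = y \<oplus>\<^bsub>?L\<^esub> x"
        by (auto simp: carrier_loc fraction_add a_comm add.commute) blast+
    next
      fix x y w assume "x \<in> carrier ?L" "y \<in> carrier ?L" "w \<in> carrier ?L"
      then show "x \<oplus>\<^bsub>?L\<^esub> y \<oplus>\<^bsub>?L\<^esub> w = x \<oplus>\<^bsub>?L\<^esub> (y \<oplus>\<^bsub>?L\<^esub> w)"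
        by (auto simp: carrier_loc fraction_add r_distr pow_pow a_assoc ac_simps)
    qed (use neg in \<open>auto simp: carrier_loc fraction_add z\<close>)
    show "Group.monoid ?L"
      by (rule monoidI) (auto simp: carrier_loc fraction_mult o m_assoc ac_simps, blast+)
  next
    fix x y w assume "x \<in> carrier ?L" "y \<in> carrier ?L" "w \<in> carrier ?L"
    then obtain a k b l c r where "x = fraction A d a k" "y = fraction A d b l" "w = fraction A d c r"
      "a \<in> carrier A" "b \<in> carrier A" "c \<in> carrier A"
      unfolding carrier_loc by blast
    note c = this
    have r1: "((d [^] l) \<otimes> a \<oplus> (d [^] k) \<otimes> b) \<otimes> c \<in> carrier A"
      and r2: "c \<otimes> ((d [^] l) \<otimes> a \<oplus> (d [^] k) \<otimes> b) \<in> carrier A"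
      using c by simp_all
    have "(d [^] r) \<otimes> (((d [^] l) \<otimes> a \<oplus> (d [^] k) \<otimes> b) \<otimes> c)
        = (d [^] (l + r)) \<otimes> (a \<otimes> c) \<oplus> (d [^] (k + r)) \<otimes> (b \<otimes> c)"
      using c by (simp add: r_distr l_distr m_assoc pow_pow add.commute)
    then show "(x \<oplus>\<^bsub>?L\<^esub> y) \<otimes>\<^bsub>?L\<^esub> w = x \<otimes>\<^bsub>?L\<^esub> w \<oplus>\<^bsub>?L\<^esub> y \<otimes>\<^bsub>?L\<^esub> w"
      using c fraction_expand[OF r1, of "k + l + r" r]
      by (simp add: fraction_mult fraction_add ac_simps)
    have "(d [^] r) \<otimes> (c \<otimes> ((d [^] l) \<otimes> a \<oplus> (d [^] k) \<otimes> b))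
        = (d [^] (r + l)) \<otimes> (c \<otimes> a) \<oplus> (d [^] (r + k)) \<otimes> (c \<otimes> b)"
      using c by (simp add: r_distr pow_lcomm[of c] pow_pow)
    then show "w \<otimes>\<^bsub>?L\<^esub> (x \<oplus>\<^bsub>?L\<^esub> y) = w \<otimes>\<^bsub>?L\<^esub> x \<oplus>\<^bsub>?L\<^esub> w \<otimes>\<^bsub>?L\<^esub> y"
      using c fraction_expand[OF r2, of "r + (k + l)" r]
      by (simp add: fraction_mult fraction_add ac_simps)
  qed
qed

lemma fraction_hom: "(\<lambda>a. fraction A d a 0) \<in> ring_hom A (localization A d)"
proof (rule ring_hom_memI)
  show "fraction A d a 0 \<in> carrier (localization A d)" if "a \<in> carrier A" for a
    using that unfolding carrier_loc by blast
  show "fraction A d \<one> 0 = \<one>\<^bsub>localization A d\<^esub>" by (simp add: one_loc)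
  fix x y assume xy: "x \<in> carrier A" "y \<in> carrier A"
  show "fraction A d (x \<otimes> y) 0 = fraction A d x 0 \<otimes>\<^bsub>localization A d\<^esub> fraction A d y 0" using xy by (simp add: fraction_mult)
  show "fraction A d (x \<oplus> y) 0 = fraction A d x 0 \<oplus>\<^bsub>localization A d\<^esub> fraction A d y 0" using xy by (simp add: fraction_add)
qed

lemma d_inverse:
  "fraction A d d 0 \<otimes>\<^bsub>localization A d\<^esub> fraction A d \<one> 1 = \<one>\<^bsub>localization A d\<^esub>"
  "fraction A d \<one> 1 \<otimes>\<^bsub>localization A d\<^esub> fraction A d d 0 = \<one>\<^bsub>localization A d\<^esub>"
proof -
  have "fraction A d \<one> 0 = fraction A d d 1"
    using fraction_expand[OF one_closed, of 0 1] by simp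
  then show "fraction A d d 0 \<otimes>\<^bsub>localization A d\<^esub> fraction A d \<one> 1 = \<one>\<^bsub>localization A d\<^esub>"
    and "fraction A d \<one> 1 \<otimes>\<^bsub>localization A d\<^esub> fraction A d d 0 = \<one>\<^bsub>localization A d\<^esub>"
    unfolding one_loc by (simp_all add: fraction_mult)
qed

end


section \<open>The localized spin affine Hecke algebra\<close>

type_synonym loc_elt = "(free set \<times> nat) set"

definition hecke_loc :: "nat \<Rightarrow> loc_elt ring" where
  "hecke_loc n = localization (spin_hecke n) (hecke_delta n)"

definition to_loc :: "nat \<Rightarrow> free \<Rightarrow> loc_elt" where
  "to_loc n x = fraction (spin_hecke n) (hecke_delta n) (hecke_class n x) 0"

abbreviation scal_loc :: "nat \<Rightarrow> cq \<Rightarrow> loc_elt" where "scal_loc n c \<equiv> to_loc n (scalF c)"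
abbreviation R_loc :: "nat \<Rightarrow> nat \<Rightarrow> loc_elt" where "R_loc n i \<equiv> to_loc n (RF i)"
abbreviation p_loc :: "nat \<Rightarrow> nat \<Rightarrow> loc_elt" where "p_loc n i \<equiv> to_loc n (pF i)"
abbreviation q_loc :: "nat \<Rightarrow> nat \<Rightarrow> loc_elt" where "q_loc n i \<equiv> to_loc n (qF i)"

definition gimel :: "nat \<Rightarrow> nat \<Rightarrow> loc_elt" where
  "gimel n i = R_loc n i \<ominus>\<^bsub>hecke_loc n\<^esub>
     scal_loc n eps \<otimes>\<^bsub>hecke_loc n\<^esub>
       (inv\<^bsub>hecke_loc n\<^esub> (p_loc n i \<ominus>\<^bsub>hecke_loc n\<^esub> p_loc n (i+1)) \<otimes>\<^bsub>hecke_loc n\<^esub>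
        (q_loc n i \<ominus>\<^bsub>hecke_loc n\<^esub> q_loc n (i+1)))"

end

theory Submission
  imports Defs "HOL-Combinatorics.Transposition"
begin

text \<open>
  The correction term \<open>a\<^sub>i = \<epsilon> (p\<^sub>i - p\<^sub>i\<^sub>+\<^sub>1)\<^sup>-\<^sup>1 (q\<^sub>i - q\<^sub>i\<^sub>+\<^sub>1)\<close> is chosen so that
  \<open>g\<^sub>i = R\<^sub>i - a\<^sub>i\<close> has no inhomogeneous terms left: it satisfies \<open>g\<^sub>i p\<^sub>j = p\<^bsub>s j\<^esub> g\<^sub>i\<close> and
  \<open>g\<^sub>i q\<^sub>j = - q\<^bsub>s j\<^esub> g\<^sub>i\<close> for the transposition \<open>s\<close> of \<open>i\<close> and \<open>i + 1\<close> (\<open>g_p\<close>, \<open>g_q\<close>).  Put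
  \<open>a\<^sub>j\<^sub>k = \<epsilon> (p\<^sub>j - p\<^sub>k)\<^sup>-\<^sup>1 (q\<^sub>j - q\<^sub>k)\<close>, which is symmetric in \<open>j\<close> and \<open>k\<close>.  Then \<open>g\<^sub>i\<close> moves past
  every \<open>a\<^sub>j\<^sub>k\<close>, permuting its indices and changing its sign (\<open>g_a\<close>).  Each relation among the
  \<open>g\<^sub>i\<close> now follows by substituting \<open>R\<^sub>i = g\<^sub>i + a\<^sub>i\<close> in the relation for the \<open>R\<^sub>i\<close> and collecting the
  \<open>g\<close> on the right.  In the quadratic relation the mixed terms cancel, so \<open>g\<^sub>i\<^sup>2 = R\<^sub>i\<^sup>2 - a\<^sub>i\<^sup>2\<close>.
  In the braid relation what remains vanishes because of the three-term identity
  \<open>a\<^sub>i\<^sub>k a\<^sub>i\<^sub>j + a\<^sub>i\<^sub>j a\<^sub>j\<^sub>k + a\<^sub>j\<^sub>k a\<^sub>i\<^sub>k = - \<epsilon>\<^sup>2\<close> (\<open>three_term\<close>): after the denominators are cleared, the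
  mixed products of the \<open>q\<close> cancel by anticommutation, and \<open>q\<^sup>2 = 1 - p\<^sup>2\<close> leaves the
  Vandermonde determinant.

  Two facts have to be derived from the presentation first.  The presentation moves \<open>R\<^sub>i\<close> past
  \<open>p\<^sub>i\<close> and \<open>q\<^sub>i\<close> only; the rules for \<open>p\<^sub>i\<^sub>+\<^sub>1\<close> and \<open>q\<^sub>i\<^sub>+\<^sub>1\<close> follow because
  \<open>R\<^sub>i\<^sup>2 = - \<epsilon>\<^sup>2 - 2\<close> is an invertible scalar (\<open>r_p_Suc\<close>, \<open>r_q_Suc\<close>).  And fractions with denominator a
  power of \<open>\<delta>\<close> form a ring because \<open>\<delta>\<close> is central (\<open>r_discriminant\<close>, \<open>hecke_delta_central\<close>).

  The calculations take place in the type class \<^class>\<open>ring\<close>, where rewriting is much more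
  effective than with explicit carriers.  The algebras themselves depend on \<open>n\<close> and so are not
  types; instead, a ring with an explicit carrier is embedded, as one factor, in the product of
  all rings on the same underlying type.  The embedding is injective and respects all operations
  except the unit, which becomes an idempotent \<open>e\<close>; this is why the abstract relations below are
  stated with such an \<open>e\<close> in place of \<open>1\<close>.
\<close>

section \<open>Rings with carriers as factors of a type-class ring\<close>

text \<open>
  The factors of the product are indexed by all records \<open>S\<close>; records that are not rings
  contribute a trivial ring, so that every factor satisfies the ring axioms.
\<close>

definition component :: "'a ring \<Rightarrow> 'a ring" where
  "component S = (if ring S then S else
     \<lparr>carrier = {undefined}, monoid.mult = (\<lambda>_ _. undefined), one = undefined,
      zero = undefined, add = (\<lambda>_ _. undefined)\<rparr>)"

lemma component_ring: "ring (component S)"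
proof (cases "ring S")
  case False
  have "ring \<lparr>carrier = {undefined}, monoid.mult = (\<lambda>_ _. undefined), one = undefined,
      zero = undefined, add = (\<lambda>_ _. undefined)\<rparr>"
    by (intro ringI abelian_groupI monoidI) auto
  with False show ?thesis by (simp add: component_def)
qed (simp add: component_def)

interpretation component: ring "component S" for S
  by (rule component_ring)

typedef 'a ring_family = "{f :: 'a ring \<Rightarrow> 'a. \<forall>S. f S \<in> carrier (component S)}"
  by (rule exI[of _ "\<lambda>S. \<zero>\<^bsub>component S\<^esub>"]) simp

lemma Rep_ring_family_carrier [simp]: "Rep_ring_family f S \<in> carrier (component S)"
  using Rep_ring_family[of f] by simp

setup_lifting type_definition_ring_family

instantiation ring_family :: (type) ring
begin

lift_definition zero_ring_family :: "'a ring_family" is "\<lambda>S. \<zero>\<^bsub>component S\<^esub>" by simp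
lift_definition plus_ring_family :: "'a ring_family \<Rightarrow> 'a ring_family \<Rightarrow> 'a ring_family"
  is "\<lambda>f g S. f S \<oplus>\<^bsub>component S\<^esub> g S" by simp
lift_definition times_ring_family :: "'a ring_family \<Rightarrow> 'a ring_family \<Rightarrow> 'a ring_family"
  is "\<lambda>f g S. f S \<otimes>\<^bsub>component S\<^esub> g S" by simp
lift_definition uminus_ring_family :: "'a ring_family \<Rightarrow> 'a ring_family"
  is "\<lambda>f S. \<ominus>\<^bsub>component S\<^esub> f S" by simp
lift_definition minus_ring_family :: "'a ring_family \<Rightarrow> 'a ring_family \<Rightarrow> 'a ring_family"
  is "\<lambda>f g S. f S \<ominus>\<^bsub>component S\<^esub> g S" by simp

instance
  by standard
     (simp_all add: Rep_ring_family_inject[symmetric] fun_eq_iff Rep_ring_family_carrier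
        zero_ring_family.rep_eq plus_ring_family.rep_eq times_ring_family.rep_eq
        uminus_ring_family.rep_eq minus_ring_family.rep_eq a_minus_def component.l_neg component.r_neg
        component.a_ac component.m_assoc component.l_distr component.r_distr)

end

text \<open>
  Outside the carrier the value is the junk value 0, which makes the function total.
\<close>

lift_definition in_family :: "'a ring \<Rightarrow> 'a \<Rightarrow> 'a ring_family" is
  "\<lambda>S x T. if T = S \<and> x \<in> carrier (component S) then x else \<zero>\<^bsub>component T\<^esub>"
  by simp

context
  fixes S :: "'a ring"
  assumes S: "ring S"
begin

interpretation ring S by (rule S)

lemma component_eq: "component S = S"
  using S by (simp add: component_def)

lemma in_family_inject:
  assumes "x \<in> carrier S" "y \<in> carrier S"
  shows "in_family S x = in_family S y \<longleftrightarrow> x = y"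
  using assms by (auto simp: Rep_ring_family_inject[symmetric] in_family.rep_eq fun_eq_iff component_eq split: if_splits)

lemma in_family_mult:
  assumes "x \<in> carrier S" "y \<in> carrier S"
  shows "in_family S (x \<otimes>\<^bsub>S\<^esub> y) = in_family S x * in_family S y"
  using assms by (auto simp: Rep_ring_family_inject[symmetric] in_family.rep_eq fun_eq_iff component_eq
      times_ring_family.rep_eq plus_ring_family.rep_eq uminus_ring_family.rep_eq minus_ring_family.rep_eq)

lemma in_family_add:
  assumes "x \<in> carrier S" "y \<in> carrier S"
  shows "in_family S (x \<oplus>\<^bsub>S\<^esub> y) = in_family S x + in_family S y"
  using assms by (auto simp: Rep_ring_family_inject[symmetric] in_family.rep_eq fun_eq_iff component_eq
      times_ring_family.rep_eq plus_ring_family.rep_eq uminus_ring_family.rep_eq minus_ring_family.rep_eq)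

lemma in_family_uminus:
  assumes "x \<in> carrier S"
  shows "in_family S (\<ominus>\<^bsub>S\<^esub> x) = - in_family S x"
  using assms by (auto simp: Rep_ring_family_inject[symmetric] in_family.rep_eq fun_eq_iff component_eq
      times_ring_family.rep_eq plus_ring_family.rep_eq uminus_ring_family.rep_eq minus_ring_family.rep_eq)

lemma in_family_minus:
  assumes "x \<in> carrier S" "y \<in> carrier S"
  shows "in_family S (x \<ominus>\<^bsub>S\<^esub> y) = in_family S x - in_family S y"
  using assms by (auto simp: Rep_ring_family_inject[symmetric] in_family.rep_eq fun_eq_iff component_eq
      times_ring_family.rep_eq plus_ring_family.rep_eq uminus_ring_family.rep_eq minus_ring_family.rep_eq a_minus_def)

end

section \<open>Consequences of the defining relations\<close>

text \<open>
  Turns a rewrite rule for a product of two factors into the form in which it applies inside a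
  product that associates to the right, which is the normal form for \<open>algebra_simps\<close>.
\<close>

lemma mult_assoc_rule: "a * b = c \<Longrightarrow> a * (b * z) = c * (z :: 'a :: ring)"
  by (simp add: mult.assoc[symmetric])

lemma commute_mult:
  "z * x = x * z \<Longrightarrow> z * y = y * z \<Longrightarrow> z * (x * y) = x * y * (z :: 'a :: ring)"
  by (metis mult.assoc)

text \<open>
  For \<open>x = p\<^sub>i - p\<^sub>i\<^sub>+\<^sub>1\<close>: moving \<open>R\<close> past \<open>x\<close> twice restores the sign, and the two inhomogeneous
  terms cancel.
\<close>

lemma square_commute_if_reflected:
  fixes R x y E :: "'a :: ring"
  assumes "R * x = - (x * R) + E" "E * x = x * E"
  shows "R * (x * x) = x * x * R"
proof -
  have "R * (x * x) = (R * x) * x" by (simp add: mult.assoc)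
  also have "\<dots> = x * x * R"
    by (simp add: assms algebra_simps)
  finally show ?thesis .
qed

text \<open>
  For \<open>x = p\<^sub>i - p\<^sub>k\<close> and \<open>y = p\<^sub>i\<^sub>+\<^sub>1 - p\<^sub>k\<close>: already \<open>x y\<close> commutes with \<open>R\<close>, because its two
  inhomogeneous terms have opposite signs.
\<close>

lemma square_product_commute_if_swapped:
  fixes R x y E :: "'a :: ring"
  assumes "R * x = y * R + E" "R * y = x * R - E"
    and "x * y = y * x" "E * y = y * E"
  shows "R * (x * x * (y * y)) = x * x * (y * y) * R"
proof -
  have R: "R * (x * y) = x * y * R"
  proof -
    have "R * (x * y) = (R * x) * y" by (simp add: mult.assoc)
    also have "\<dots> = y * x * R"
      by (simp add: assms(1,2,4) algebra_simps)
    finally show ?thesis by (simp add: assms(3))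
  qed
  have "x * x * (y * y) = (x * y) * (x * y)"
    using assms(3) by (metis mult.assoc)
  then show ?thesis
    using R by (metis mult.assoc)
qed

text \<open>
  The braid relation for the intertwiners, with \<open>g, h\<close> in the role of \<open>g\<^sub>i, g\<^sub>i\<^sub>+\<^sub>1\<close> and
  \<open>A, B, C\<close> in the role of \<open>a\<^sub>i\<^sub>j, a\<^sub>j\<^sub>k, a\<^sub>i\<^sub>k\<close> for \<open>j = i + 1\<close>, \<open>k = i + 2\<close>.  Once the \<open>g\<close> and \<open>h\<close> are
  collected on the right, the terms with two of them cancel up to \<open>C (h\<^sup>2 - g\<^sup>2)\<close>, the linear terms match
  \<open>t (h - g)\<close> by the three-term identities, and so does the remainder, after these identities are
  multiplied by \<open>A\<close> or \<open>B\<close>.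
\<close>

lemma braid_relation_of_shifted:
  fixes g h A B C t s :: "'a :: ring"
  assumes g: "g * A = - (A * g)" "g * B = - (C * g)" "g * C = - (B * g)"
    and h: "h * B = - (B * h)" "h * A = - (C * h)" "h * C = - (A * h)"
    and sq: "g * g = s - A * A" "h * h = s - B * B"
    and three: "C * A + A * B + B * C = - t" "A * C + C * B + B * A = - t"
    and comm: "B * B * C = C * (B * B)" "t * B = B * t"
    and braid: "(g + A) * (h + B) * (g + A) - (h + B) * (g + A) * (h + B)
      = t * ((h + B) - (g + A))"
  shows "g * h * g = h * g * h"
proof -
  note rules = g h
  note rules = rules rules[THEN mult_assoc_rule]
  have 1: "g * h * g - h * g * h - C * (g * g) + C * (h * h) + (C * A + A * B + B * C) * g
      - (A * C + C * B + B * A) * h + A * B * A - B * A * B = t * (h + B - g - A)"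
    using braid by (simp add: algebra_simps rules)
  have 2: "g * h * g - h * g * h = t * B - t * A - A * B * A + B * A * B - C * (A * A) + C * (B * B)"
    using 1 unfolding three sq by (simp add: algebra_simps)
  have CAA: "C * (A * A) = - (t * A) - A * B * A - B * C * A"
  proof -
    have "(C * A + A * B + B * C) * A = - t * A" using three by simp
    then show ?thesis by (simp add: algebra_simps eq_neg_iff_add_eq_0)
  qed
  have CBB: "C * (B * B) = - (t * B) - A * C * B - B * A * B"
  proof -
    have "(A * C + C * B + B * A) * B = - t * B" using three by simp
    then show ?thesis by (simp add: algebra_simps eq_neg_iff_add_eq_0)
  qed
  have "B * C * A = A * C * B"
  proof -
    have "B * (C * A + A * B + B * C) = - (t * B)" using three comm by simp
    then have "B * C * A = - (t * B) - B * A * B - C * (B * B)"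
      using comm(1) by (simp add: algebra_simps eq_neg_iff_add_eq_0)
    then show ?thesis using CBB by (simp add: algebra_simps)
  qed
  then show ?thesis
    using 2 CAA CBB by (simp add: algebra_simps)
qed

text \<open>
  The relations of the spin affine Hecke algebra in a ring with local unit \<open>e\<close>.  The element
  \<open>\<kappa>\<close> stands for the scalar \<open>1 / (2 (\<epsilon>\<^sup>2 + 2))\<close>: it makes both 2 and \<open>R\<^sub>i\<^sup>2\<close> cancellable.
\<close>

locale spin_hecke_relations =
  fixes n :: nat and e \<epsilon> \<kappa> :: "'a :: ring" and r p q :: "nat \<Rightarrow> 'a"
  assumes e_unit [simp]:
      "e * e = e" "e * \<epsilon> = \<epsilon>" "\<epsilon> * e = \<epsilon>"
      "\<And>i. i \<in> {1..<n} \<Longrightarrow> e * r i = r i" "\<And>i. i \<in> {1..<n} \<Longrightarrow> r i * e = r i"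
      "\<And>j. j \<in> {1..n} \<Longrightarrow> e * p j = p j" "\<And>j. j \<in> {1..n} \<Longrightarrow> p j * e = p j"
      "\<And>j. j \<in> {1..n} \<Longrightarrow> e * q j = q j" "\<And>j. j \<in> {1..n} \<Longrightarrow> q j * e = q j"
    and \<epsilon>_central:
      "\<And>i. i \<in> {1..<n} \<Longrightarrow> r i * \<epsilon> = \<epsilon> * r i"
      "\<And>j. j \<in> {1..n} \<Longrightarrow> p j * \<epsilon> = \<epsilon> * p j"
      "\<And>j. j \<in> {1..n} \<Longrightarrow> q j * \<epsilon> = \<epsilon> * q j"
    and \<kappa>: "\<kappa> * (\<epsilon> * \<epsilon> + e + e) + \<kappa> * (\<epsilon> * \<epsilon> + e + e) = e"
    and r_sq: "\<And>i. i \<in> {1..<n} \<Longrightarrow> r i * r i = - (\<epsilon> * \<epsilon>) - e - e"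
    and r_r: "\<And>i j. \<lbrakk>i \<in> {1..<n}; j \<in> {1..<n}; \<bar>int i - int j\<bar> > 1\<rbrakk> \<Longrightarrow> r i * r j = - (r j * r i)"
    and r_braid: "\<And>i. \<lbrakk>i \<in> {1..<n}; Suc i \<in> {1..<n}\<rbrakk> \<Longrightarrow>
      r i * r (Suc i) * r i - r (Suc i) * r i * r (Suc i) = \<epsilon> * \<epsilon> * (r (Suc i) - r i)"
    and p_p: "\<And>j k. \<lbrakk>j \<in> {1..n}; k \<in> {1..n}\<rbrakk> \<Longrightarrow> p j * p k = p k * p j"
    and q_q: "\<And>j k. \<lbrakk>j \<in> {1..n}; k \<in> {1..n}; j \<noteq> k\<rbrakk> \<Longrightarrow> q j * q k = - (q k * q j)"
    and p_q: "\<And>j k. \<lbrakk>j \<in> {1..n}; k \<in> {1..n}\<rbrakk> \<Longrightarrow> p j * q k = q k * p j"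
    and q_sq: "\<And>j. j \<in> {1..n} \<Longrightarrow> q j * q j = e - p j * p j"
    and r_p_far: "\<And>i j. \<lbrakk>i \<in> {1..<n}; j \<in> {1..n}; j \<noteq> i; j \<noteq> Suc i\<rbrakk> \<Longrightarrow> r i * p j = p j * r i"
    and r_q_far: "\<And>i j. \<lbrakk>i \<in> {1..<n}; j \<in> {1..n}; j \<noteq> i; j \<noteq> Suc i\<rbrakk> \<Longrightarrow> r i * q j = - (q j * r i)"
    and r_p: "\<And>i. i \<in> {1..<n} \<Longrightarrow> r i * p i = p (Suc i) * r i + \<epsilon> * (q i - q (Suc i))"
    and r_q: "\<And>i. i \<in> {1..<n} \<Longrightarrow> r i * q i = - (q (Suc i) * r i) - \<epsilon> * (p i + p (Suc i))"
begin

text \<open>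
  Let \<open>X\<close> and \<open>Y\<close> be the defects of the two rules, and \<open>s = R\<^sub>i\<^sup>2\<close>.  Multiplying the
  defining rules for \<open>p\<^sub>i\<close> and \<open>q\<^sub>i\<close> by \<open>R\<^sub>i\<close> on both sides gives \<open>s X = \<epsilon> Y R\<^sub>i\<close> and \<open>s Y = - \<epsilon> X R\<^sub>i\<close>.
  Hence \<open>s\<^sup>2 X = - \<epsilon>\<^sup>2 s X\<close>, that is \<open>- 2 s X = 0\<close>, and \<open>X\<close> and then \<open>Y\<close> vanish.
\<close>

lemma
  assumes i: "i \<in> {1..<n}"
  shows r_p_Suc: "r i * p (Suc i) = p i * r i - \<epsilon> * (q i - q (Suc i))"
    and r_q_Suc: "r i * q (Suc i) = - (q i * r i) - \<epsilon> * (p i + p (Suc i))"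
proof -
  have j: "i \<in> {1..n}" "Suc i \<in> {1..n}" using i by auto
  define s where "s = - (\<epsilon> * \<epsilon>) - e - e"
  define X where "X = r i * p (Suc i) - p i * r i + \<epsilon> * (q i - q (Suc i))"
  define Y where "Y = r i * q (Suc i) + q i * r i + \<epsilon> * (p i + p (Suc i))"
  note unit = e_unit(4,5)[OF i] e_unit(6-9)[OF j(1)] e_unit(6-9)[OF j(2)] e_unit(1-3)
  note central = \<epsilon>_central(1)[OF i] \<epsilon>_central(2,3)[OF j(1)] \<epsilon>_central(2,3)[OF j(2)]
  note rules = unit central r_sq[OF i] r_p[OF i] r_q[OF i]
  note rules = rules rules[THEN mult_assoc_rule]
  have eX: "e * X = X" and eY: "e * Y = Y"
    by (simp_all add: X_def Y_def algebra_simps rules)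
  have sX: "s * X = \<epsilon> * (Y * r i)"
  proof -
    \<comment> \<open>The two factors of \<open>s = r i * r i\<close> are separated: the inner one is moved past \<open>p i\<close>.\<close>
    have "s * p i * r i = r i * (p (Suc i) * r i + \<epsilon> * (q i - q (Suc i))) * r i"
      by (simp only: s_def r_p[OF i, symmetric] r_sq[OF i, symmetric] mult.assoc)
    then show ?thesis
      by (simp add: X_def Y_def s_def algebra_simps rules)
  qed
  have sY: "s * Y = - (\<epsilon> * (X * r i))"
  proof -
    have "s * q i * r i = r i * (- (q (Suc i) * r i) - \<epsilon> * (p i + p (Suc i))) * r i"
      by (simp only: s_def r_q[OF i, symmetric] r_sq[OF i, symmetric] mult.assoc)
    then show ?thesis
      by (simp add: X_def Y_def s_def algebra_simps rules)
  qed
  have cancel: "x = 0" if "e * x = x" "s * x + s * x = 0" for x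
  proof -
    have "x = (\<kappa> * (\<epsilon> * \<epsilon> + e + e) + \<kappa> * (\<epsilon> * \<epsilon> + e + e)) * x"
      using \<kappa> that by simp
    also have "\<dots> = - \<kappa> * (s * x + s * x)"
      by (simp add: s_def algebra_simps)
    finally show "x = 0" using that by simp
  qed
  have "s * (s * X) = - (\<epsilon> * (\<epsilon> * (s * X)))"
  proof -
    have "s * (s * X) = \<epsilon> * ((s * Y) * r i)"
      unfolding sX by (simp add: s_def algebra_simps rules)
    also have "\<dots> = - (\<epsilon> * (\<epsilon> * (X * (r i * r i))))"
      by (simp add: sY algebra_simps)
    also have "X * (r i * r i) = s * X"
      by (simp add: X_def s_def algebra_simps rules)
    finally show ?thesis .
  qed
  then have "s * X + s * X = 0"
    by (simp add: s_def algebra_simps eX rules neg_eq_iff_add_eq_0)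
  with cancel eX have X: "X = 0" by blast
  with sY cancel[of Y] eY have Y: "Y = 0" by simp
  show "r i * p (Suc i) = p i * r i - \<epsilon> * (q i - q (Suc i))"
    using X unfolding X_def by (simp add: algebra_simps)
  show "r i * q (Suc i) = - (q i * r i) - \<epsilon> * (p i + p (Suc i))"
    using Y unfolding Y_def by (simp add: algebra_simps eq_neg_iff_add_eq_0)
qed


section \<open>The discriminant is central\<close>

text \<open>
  \<^const>\<open>prod_list\<close> would start from the unit of the type, which the class \<^class>\<open>ring\<close> does not have.
\<close>

definition ordered_prod :: "'a list \<Rightarrow> 'a" where
  "ordered_prod xs = foldr (*) xs e"

lemma ordered_prod_simps [simp]:
  "ordered_prod [] = e"
  "ordered_prod (x # xs) = x * ordered_prod xs"
  by (simp_all add: ordered_prod_def)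

lemma ordered_prod_unit: "\<forall>x\<in>set xs. e * x = x \<Longrightarrow> e * ordered_prod xs = ordered_prod xs"
  by (induction xs) (auto simp: mult.assoc[symmetric])

lemma ordered_prod_append:
  "\<forall>y\<in>set ys. e * y = y \<Longrightarrow> ordered_prod (xs @ ys) = ordered_prod xs * ordered_prod ys"
  by (induction xs) (simp_all add: ordered_prod_unit mult.assoc)

lemma ordered_prod_concat:
  "\<forall>xs\<in>set xss. \<forall>x\<in>set xs. e * x = x \<Longrightarrow>
     ordered_prod (concat xss) = ordered_prod (map ordered_prod xss)"
  by (induction xss) (auto simp: ordered_prod_append)

lemma commute_ordered_prod:
  assumes "z * e = e * z" "\<forall>x\<in>set xs. z * x = x * z"
  shows "z * ordered_prod xs = ordered_prod xs * z"
  using assms(2)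
proof (induction xs)
  case (Cons x xs)
  then have "z * (x * ordered_prod xs) = x * (z * ordered_prod xs)"
    by (metis list.set_intros(1) mult.assoc)
  with Cons show ?case by (simp add: mult.assoc)
qed (simp add: assms)

lemma ordered_prod_merge:
  assumes "\<forall>x\<in>set xs. e * f x = f x \<and> e * g x = g x \<and> g x * e = g x"
    and "\<forall>x\<in>set xs. \<forall>y\<in>set xs. g x * f y = f y * g x"
  shows "ordered_prod (map f xs) * ordered_prod (map g xs) = ordered_prod (map (\<lambda>x. f x * g x) xs)"
  using assms
proof (induction xs)
  case (Cons x xs)
  have "g x * ordered_prod (map f xs) = ordered_prod (map f xs) * g x"
    using Cons.prems by (intro commute_ordered_prod) auto
  then have "ordered_prod (map f xs) * (g x * ordered_prod (map g xs))
      = g x * (ordered_prod (map f xs) * ordered_prod (map g xs))"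
    by (simp add: mult.assoc[symmetric])
  also have "\<dots> = g x * ordered_prod (map (\<lambda>x. f x * g x) xs)"
    using Cons by simp
  finally show ?case by (simp add: mult.assoc)
qed simp

definition sq_diff :: "nat \<Rightarrow> nat \<Rightarrow> 'a" where
  "sq_diff j k = (p j - p k) * (p j - p k)"

lemma sq_diff_sym: "sq_diff j k = sq_diff k j"
  by (simp add: sq_diff_def algebra_simps)

lemma sq_diff_unit [simp]:
  "\<lbrakk>j \<in> {1..n}; k \<in> {1..n}\<rbrakk> \<Longrightarrow> e * sq_diff j k = sq_diff j k"
  "\<lbrakk>j \<in> {1..n}; k \<in> {1..n}\<rbrakk> \<Longrightarrow> sq_diff j k * e = sq_diff j k"
  by (simp_all add: sq_diff_def algebra_simps mult_assoc_rule[OF e_unit(6)])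

lemma commute_sq_diff: "x * p j = p j * x \<Longrightarrow> x * p k = p k * x \<Longrightarrow> x * sq_diff j k = sq_diff j k * x"
proof -
  assume "x * p j = p j * x" "x * p k = p k * x"
  then have "x * (p j - p k) = (p j - p k) * x" by (simp add: algebra_simps)
  then show ?thesis unfolding sq_diff_def by (metis mult.assoc)
qed

lemma r_sq_diff_far:
  "\<lbrakk>i \<in> {1..<n}; j \<in> {1..n}; k \<in> {1..n}; j \<notin> {i, Suc i}; k \<notin> {i, Suc i}\<rbrakk> \<Longrightarrow>
     r i * sq_diff j k = sq_diff j k * r i"
  by (intro commute_sq_diff r_p_far) auto

lemma r_sq_diff_same:
  assumes i: "i \<in> {1..<n}"
  shows "r i * sq_diff i (Suc i) = sq_diff i (Suc i) * r i"
proof -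
  have j: "i \<in> {1..n}" "Suc i \<in> {1..n}" using i by auto
  define E where "E = \<epsilon> * (q i - q (Suc i)) + \<epsilon> * (q i - q (Suc i))"
  note rules = \<epsilon>_central(2)[OF j(1)] \<epsilon>_central(2)[OF j(2)]
     p_q[OF j(1) j(1)] p_q[OF j(1) j(2)] p_q[OF j(2) j(1)] p_q[OF j(2) j(2)]
  show ?thesis
    unfolding sq_diff_def
  proof (rule square_commute_if_reflected)
    show "r i * (p i - p (Suc i)) = - ((p i - p (Suc i)) * r i) + E"
      by (simp add: E_def algebra_simps r_p[OF i] r_p_Suc[OF i])
    show "E * (p i - p (Suc i)) = (p i - p (Suc i)) * E"
      by (simp add: E_def algebra_simps rules rules[THEN mult_assoc_rule])
  qed
qed

lemma r_sq_diff_pair: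
  assumes i: "i \<in> {1..<n}" and k: "k \<in> {1..n}" "k \<notin> {i, Suc i}"
  shows "r i * (sq_diff i k * sq_diff (Suc i) k) = sq_diff i k * sq_diff (Suc i) k * r i"
proof -
  have j: "i \<in> {1..n}" "Suc i \<in> {1..n}" using i by auto
  define E where "E = \<epsilon> * (q i - q (Suc i))"
  note rules = \<epsilon>_central(2)[OF j(1)] \<epsilon>_central(2)[OF j(2)] \<epsilon>_central(2)[OF k(1)]
     p_q[OF j(1) j(1)] p_q[OF j(1) j(2)] p_q[OF j(2) j(1)] p_q[OF j(2) j(2)]
     p_q[OF k(1) j(1)] p_q[OF k(1) j(2)] p_p[OF j(2) j(1)] p_p[OF k(1) j(1)] p_p[OF k(1) j(2)]
  show ?thesis
    unfolding sq_diff_def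
  proof (rule square_product_commute_if_swapped)
    show "r i * (p i - p k) = (p (Suc i) - p k) * r i + E"
      using k by (simp add: E_def algebra_simps r_p[OF i] r_p_far[OF i])
    show "r i * (p (Suc i) - p k) = (p i - p k) * r i - E"
      using k by (simp add: E_def algebra_simps r_p_Suc[OF i] r_p_far[OF i])
    show "(p i - p k) * (p (Suc i) - p k) = (p (Suc i) - p k) * (p i - p k)"
      by (simp add: algebra_simps rules rules[THEN mult_assoc_rule])
    show "E * (p (Suc i) - p k) = (p (Suc i) - p k) * E"
      by (simp add: E_def algebra_simps rules rules[THEN mult_assoc_rule])
  qed
qed

definition discriminant :: 'a where
  "discriminant = ordered_prod [sq_diff j k. j \<leftarrow> [1..<Suc n], k \<leftarrow> [Suc j..<Suc n]]"

lemma discriminant_commute: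
  assumes "z * e = e * z" "\<And>j. j \<in> {1..n} \<Longrightarrow> z * p j = p j * z"
  shows "z * discriminant = discriminant * z"
  unfolding discriminant_def
  using assms by (intro commute_ordered_prod) (auto intro!: commute_sq_diff)

text \<open>
  In the product over \<open>j < k\<close>, taken row by row, the factors that \<open>R\<^sub>i\<close> does not commute with
  come in pairs that it does commute with.  In a row \<open>j < i\<close> the two factors for \<open>k = i\<close> and
  \<open>k = i + 1\<close> are adjacent.  The rows \<open>i\<close> and \<open>i + 1\<close> are adjacent, and apart from the factor
  \<open>(p\<^sub>i - p\<^sub>i\<^sub>+\<^sub>1)\<^sup>2\<close> they run over the same \<open>k\<close>, so that they can be merged into one product of
  pairs.  All other rows commute with \<open>R\<^sub>i\<close> factor by factor.
\<close>

lemma r_discriminant: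
  assumes i: "i \<in> {1..<n}"
  shows "r i * discriminant = discriminant * r i"
proof -
  let ?row = "\<lambda>j. map (sq_diff j) [Suc j..<Suc n]"
  let ?rest = "[Suc (Suc i)..<Suc n]"
  define row where "row j = ordered_prod (?row j)" for j
  have re: "r i * e = e * r i" using i by simp
  have split: "[a..<Suc n] = [a..<i] @ [i, Suc i] @ ?rest" if "a \<le> i" for a
    using that i upt_add_eq_append[of a i "Suc n - i"] by (simp add: upt_conv_Cons)
  have row_unit: "e * row j = row j" if "j \<in> {1..n}" for j
    unfolding row_def using that by (intro ordered_prod_unit) auto
  have low: "r i * row j = row j * r i" if "j \<in> {1..<i}" for j
  proof -
    have j: "j \<in> {1..n}" "j \<notin> {i, Suc i}" using that i by auto
    have "row j = ordered_prod (map (sq_diff j) [Suc j..<i]) *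
        ((sq_diff i j * sq_diff (Suc i) j) * ordered_prod (map (sq_diff j) ?rest))"
      unfolding row_def using that i
      by (subst split) (auto simp: ordered_prod_append sq_diff_sym[of j] mult.assoc simp del: upt_Suc)
    moreover have "r i * ordered_prod (map (sq_diff j) [Suc j..<i]) =
        ordered_prod (map (sq_diff j) [Suc j..<i]) * r i"
      using i that by (intro commute_ordered_prod re) (auto intro!: r_sq_diff_far)
    moreover have "r i * ordered_prod (map (sq_diff j) ?rest) =
        ordered_prod (map (sq_diff j) ?rest) * r i"
      using i that by (intro commute_ordered_prod re) (auto intro!: r_sq_diff_far)
    ultimately show ?thesis
      using r_sq_diff_pair[OF i j] by (simp only:) (blast intro: commute_mult)
  qed
  have high: "r i * row j = row j * r i" if "j \<in> set ?rest" for j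
    unfolding row_def using i that
    by (intro commute_ordered_prod re) (auto intro!: r_sq_diff_far)
  have mid: "r i * (row i * row (Suc i)) = row i * row (Suc i) * r i"
  proof -
    have "row i * row (Suc i) = sq_diff i (Suc i) *
        (ordered_prod (map (sq_diff i) ?rest) * ordered_prod (map (sq_diff (Suc i)) ?rest))"
      unfolding row_def using i by (simp add: upt_conv_Cons mult.assoc del: upt_Suc)
    also have "ordered_prod (map (sq_diff i) ?rest) * ordered_prod (map (sq_diff (Suc i)) ?rest)
        = ordered_prod (map (\<lambda>k. sq_diff i k * sq_diff (Suc i) k) ?rest)"
      using i by (intro ordered_prod_merge) (auto intro!: commute_sq_diff commute_sq_diff[symmetric] p_p)
    finally have "row i * row (Suc i) = sq_diff i (Suc i) *
        ordered_prod (map (\<lambda>k. sq_diff i k * sq_diff (Suc i) k) ?rest)" .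
    moreover have "r i * ordered_prod (map (\<lambda>k. sq_diff i k * sq_diff (Suc i) k) ?rest)
        = ordered_prod (map (\<lambda>k. sq_diff i k * sq_diff (Suc i) k) ?rest) * r i"
      using i by (intro commute_ordered_prod re) (auto intro!: r_sq_diff_pair)
    ultimately show ?thesis
      using r_sq_diff_same[OF i] by (simp only:) (blast intro: commute_mult)
  qed
  have "discriminant = ordered_prod (map row [1..<Suc n])"
    unfolding discriminant_def row_def
    by (subst ordered_prod_concat) (auto simp: comp_def simp del: upt_Suc)
  also have "\<dots> = ordered_prod (map row [1..<i]) *
      ((row i * row (Suc i)) * ordered_prod (map row ?rest))"
    using i by (subst split) (auto simp: ordered_prod_append row_unit mult.assoc simp del: upt_Suc)
  finally have "discriminant = \<dots>" .
  moreover have "r i * ordered_prod (map row [1..<i]) = ordered_prod (map row [1..<i]) * r i"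
    using low by (intro commute_ordered_prod re) auto
  moreover have "r i * ordered_prod (map row ?rest) = ordered_prod (map row ?rest) * r i"
    using high by (intro commute_ordered_prod re) (auto simp del: upt_Suc)
  ultimately show ?thesis
    using mid by (simp only:) (blast intro: commute_mult)
qed

end

section \<open>Intertwiners in the localization\<close>

text \<open>
  The element \<open>u j k\<close> is the inverse of \<open>p\<^sub>j - p\<^sub>k\<close> with respect to the local unit.
\<close>

locale localized_spin_hecke_relations = spin_hecke_relations +
  fixes u :: "nat \<Rightarrow> nat \<Rightarrow> 'a"
  assumes u_inverse:
      "\<And>j k. \<lbrakk>j \<in> {1..n}; k \<in> {1..n}; j \<noteq> k\<rbrakk> \<Longrightarrow> u j k * (p j - p k) = e"
      "\<And>j k. \<lbrakk>j \<in> {1..n}; k \<in> {1..n}; j \<noteq> k\<rbrakk> \<Longrightarrow> (p j - p k) * u j k = e"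
    and u_unit [simp]:
      "\<And>j k. \<lbrakk>j \<in> {1..n}; k \<in> {1..n}; j \<noteq> k\<rbrakk> \<Longrightarrow> e * u j k = u j k"
      "\<And>j k. \<lbrakk>j \<in> {1..n}; k \<in> {1..n}; j \<noteq> k\<rbrakk> \<Longrightarrow> u j k * e = u j k"
begin

text \<open>
  An element that carries \<open>p\<^sub>j - p\<^sub>k\<close> to \<open>p\<^bsub>j'\<^esub> - p\<^bsub>k'\<^esub>\<close> carries the inverses to each other.  With equal
  index pairs this says that the inverses commute with whatever the \<open>p\<close> commute with.
\<close>

lemma u_intertwine:
  assumes jk: "j \<in> {1..n}" "k \<in> {1..n}" "j \<noteq> k" "j' \<in> {1..n}" "k' \<in> {1..n}" "j' \<noteq> k'"
    and x: "e * x = x" "x * e = x" "x * p j = p j' * x" "x * p k = p k' * x"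
  shows "x * u j k = u j' k' * x"
proof -
  have "x * (p j - p k) = (p j' - p k') * x"
    using x by (simp add: algebra_simps)
  then have "u j' k' * (x * (p j - p k)) * u j k = u j' k' * (p j' - p k') * x * u j k"
    by (simp add: mult.assoc)
  then show ?thesis
    by (simp add: u_inverse(1)[OF jk(4-6)] u_inverse(2)[OF jk(1-3)] mult.assoc x
        u_inverse(1)[OF jk(4-6), THEN mult_assoc_rule] mult_assoc_rule[OF x(1)] u_unit jk)
qed

lemma u_antisym: "\<lbrakk>j \<in> {1..n}; k \<in> {1..n}; j \<noteq> k\<rbrakk> \<Longrightarrow> u k j = - u j k"
proof -
  assume j: "j \<in> {1..n}" "k \<in> {1..n}" "j \<noteq> k"
  have "u k j = u k j * ((p j - p k) * u j k)" using j by (simp add: u_inverse)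
  also have "\<dots> = - (u k j * (p k - p j)) * u j k" by (simp add: algebra_simps)
  also have "\<dots> = - u j k" using j by (simp add: u_inverse(1)[of k j])
  finally show ?thesis .
qed

lemma u_central:
  assumes "j \<in> {1..n}" "k \<in> {1..n}" "j \<noteq> k"
  shows "l \<in> {1..n} \<Longrightarrow> p l * u j k = u j k * p l"
    and "l \<in> {1..n} \<Longrightarrow> q l * u j k = u j k * q l"
    and "u j k * \<epsilon> = \<epsilon> * u j k"
    and "\<lbrakk>l \<in> {1..n}; m \<in> {1..n}; l \<noteq> m\<rbrakk> \<Longrightarrow> u l m * u j k = u j k * u l m"
proof -
  show pu: "p l * u j k = u j k * p l" if "l \<in> {1..n}" for l
    using assms that by (intro u_intertwine) (auto intro: p_p)
  show "q l * u j k = u j k * q l" if "l \<in> {1..n}"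
    using assms that by (intro u_intertwine) (auto simp: p_q)
  show "u j k * \<epsilon> = \<epsilon> * u j k"
    using assms by (intro u_intertwine[symmetric]) (auto simp: \<epsilon>_central)
  show "u l m * u j k = u j k * u l m" if "l \<in> {1..n}" "m \<in> {1..n}" "l \<noteq> m"
    using assms that
    by (intro u_intertwine) (auto intro!: u_intertwine[symmetric] p_p)
qed

definition a :: "nat \<Rightarrow> nat \<Rightarrow> 'a" where
  "a j k = \<epsilon> * (u j k * (q j - q k))"

lemma a_sym: "\<lbrakk>j \<in> {1..n}; k \<in> {1..n}; j \<noteq> k\<rbrakk> \<Longrightarrow> a k j = a j k"
  by (simp add: a_def u_antisym[of j k] algebra_simps)

lemma a_unit [simp]:
  assumes "j \<in> {1..n}" "k \<in> {1..n}" "j \<noteq> k"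
  shows "e * a j k = a j k" "a j k * e = a j k"
  using assms by (simp_all add: a_def algebra_simps mult_assoc_rule[OF e_unit(2)])

lemma p_a:
  assumes "j \<in> {1..n}" "k \<in> {1..n}" "j \<noteq> k" "l \<in> {1..n}"
  shows "p l * a j k = a j k * p l"
proof -
  note rules = \<epsilon>_central(2)[OF assms(4)] u_central(1)[OF assms(1-4)]
    p_q[OF assms(4,1)] p_q[OF assms(4,2)]
  show ?thesis
    by (simp add: a_def algebra_simps rules rules[THEN mult_assoc_rule])
qed

lemma a_mult:
  assumes jk: "j \<in> {1..n}" "k \<in> {1..n}" "j \<noteq> k" and lm: "l \<in> {1..n}" "m \<in> {1..n}" "l \<noteq> m"
  shows "a j k * a l m = \<epsilon> * \<epsilon> * (u j k * u l m * ((q j - q k) * (q l - q m)))"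
proof -
  note rules = \<epsilon>_central(3)[OF jk(1)] \<epsilon>_central(3)[OF jk(2)] u_central(3)[OF jk]
    u_central(2)[OF lm jk(1)] u_central(2)[OF lm jk(2)]
  show ?thesis
    by (simp add: a_def algebra_simps rules rules[THEN mult_assoc_rule])
qed

lemma a_square:
  assumes jk: "j \<in> {1..n}" "k \<in> {1..n}" "j \<noteq> k"
  shows "a j k * a j k = \<epsilon> * \<epsilon> * (u j k * u j k * (e + e - p j * p j - p k * p k))"
proof -
  note rules = q_q[OF jk(2,1) jk(3)[symmetric]] q_sq[OF jk(1)] q_sq[OF jk(2)]
  show ?thesis
    unfolding a_mult[OF jk jk] by (simp add: algebra_simps rules)
qed

text \<open>
  The \<open>q\<close> anticommute among themselves, so the \<open>a\<close> do not commute; but the square of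
  one involves only \<open>\<epsilon>\<close> and the \<open>p\<close>.
\<close>

lemma a_square_central:
  assumes jk: "j \<in> {1..n}" "k \<in> {1..n}" "j \<noteq> k" and lm: "l \<in> {1..n}" "m \<in> {1..n}" "l \<noteq> m"
  shows "a j k * a j k * a l m = a l m * (a j k * a j k)"
proof -
  have \<epsilon>: "a l m * \<epsilon> = \<epsilon> * a l m"
  proof -
    note rules = \<epsilon>_central(3)[OF lm(1)] \<epsilon>_central(3)[OF lm(2)] u_central(3)[OF lm]
    show ?thesis
      by (simp add: a_def algebra_simps rules rules[THEN mult_assoc_rule])
  qed
  have u: "a l m * u j k = u j k * a l m"
    using jk lm by (intro u_intertwine) (simp_all add: p_a)
  have pp: "a l m * (e + e - p j * p j - p k * p k) = (e + e - p j * p j - p k * p k) * a l m"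
  proof -
    note rules = p_a[OF lm jk(1)] p_a[OF lm jk(2)] a_unit[OF lm]
    show ?thesis
      by (simp add: algebra_simps rules rules[THEN mult_assoc_rule])
  qed
  show ?thesis
    unfolding a_square[OF jk] by (rule sym) (intro commute_mult \<epsilon> u pp)
qed

text \<open>
  The common denominator of the three products is \<open>U\<^sup>-\<^sup>1 = (p\<^sub>i - p\<^sub>j) (p\<^sub>j - p\<^sub>k) (p\<^sub>i - p\<^sub>k)\<close>.  In the sum
  of the numerators each mixed product of two \<open>q\<close> has coefficient
  \<open>\<plusminus>((p\<^sub>j - p\<^sub>k) - (p\<^sub>i - p\<^sub>k) + (p\<^sub>i - p\<^sub>j)) = 0\<close>, and the squares \<open>q\<^sup>2 = 1 - p\<^sup>2\<close> add up to \<open>- U\<^sup>-\<^sup>1\<close>.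
\<close>

lemma three_term:
  assumes i: "i \<in> {1..n}" and j: "j \<in> {1..n}" and k: "k \<in> {1..n}"
    and ij: "i \<noteq> j" and jk: "j \<noteq> k" and ik: "i \<noteq> k"
  shows "a i k * a i j + a i j * a j k + a j k * a i k = - (\<epsilon> * \<epsilon>)"
proof -
  define U where "U = u i j * (u j k * u i k)"
  have prod: "a i k * a i j = \<epsilon> * \<epsilon> * (U * ((p j - p k) * ((q i - q k) * (q i - q j))))"
    "a i j * a j k = \<epsilon> * \<epsilon> * (U * ((p i - p k) * ((q i - q j) * (q j - q k))))"
    "a j k * a i k = \<epsilon> * \<epsilon> * (U * ((p i - p j) * ((q j - q k) * (q i - q k))))"
  proof -
    have U: "U * ((p j - p k) * z) = u i k * u i j * z"
      "U * ((p i - p k) * z) = u i j * u j k * z"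
      "U * ((p i - p j) * z) = u j k * u i k * z" for z
    proof -
      have comm: "u i j * (u j k * u i k) = u i k * (u i j * u j k)"
        "u i j * (u j k * u i k) = u j k * (u i k * u i j)"
        using assms by (metis (no_types) mult.assoc u_central(4))+
      have cancel: "x * (y * u v w) * ((p v - p w) * z) = x * y * z"
        if "v \<in> {1..n}" "w \<in> {1..n}" "v \<noteq> w" "y * e = y" for x y v w
      proof -
        have "x * (y * u v w) * ((p v - p w) * z) = x * (y * (u v w * (p v - p w)) * z)"
          by (simp only: mult.assoc)
        also have "\<dots> = x * y * z"
          by (simp only: u_inverse(1)[OF that(1-3)] that(4) mult.assoc)
        finally show ?thesis .
      qed
      show "U * ((p j - p k) * z) = u i k * u i j * z"
        unfolding U_def comm(1) using assms by (intro cancel) auto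
      show "U * ((p i - p k) * z) = u i j * u j k * z"
        unfolding U_def using assms by (intro cancel) auto
      show "U * ((p i - p j) * z) = u j k * u i k * z"
        unfolding U_def comm(2) using assms by (intro cancel) auto
    qed
    show "a i k * a i j = \<epsilon> * \<epsilon> * (U * ((p j - p k) * ((q i - q k) * (q i - q j))))"
      "a i j * a j k = \<epsilon> * \<epsilon> * (U * ((p i - p k) * ((q i - q j) * (q j - q k))))"
      "a j k * a i k = \<epsilon> * \<epsilon> * (U * ((p i - p j) * ((q j - q k) * (q i - q k))))"
      unfolding U using assms by (auto intro!: a_mult)
  qed
  have vandermonde: "(p j - p k) * ((q i - q k) * (q i - q j)) + (p i - p k) * ((q i - q j) * (q j - q k))
      + (p i - p j) * ((q j - q k) * (q i - q k)) = - ((p i - p k) * ((p j - p k) * (p i - p j)))"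
  proof -
    note rules = q_q[OF j i ij[symmetric]] q_q[OF k i ik[symmetric]] q_q[OF k j jk[symmetric]]
      q_sq[OF i] q_sq[OF j] q_sq[OF k] p_p[OF j i] p_p[OF k i] p_p[OF k j]
    show ?thesis
      using i j k by (simp add: algebra_simps rules rules[THEN mult_assoc_rule])
  qed
  have "U * ((p i - p k) * ((p j - p k) * (p i - p j))) = e"
  proof -
    have "U * ((p i - p k) * ((p j - p k) * (p i - p j)))
        = u i j * ((u j k * ((u i k * (p i - p k)) * (p j - p k))) * (p i - p j))"
      by (simp only: U_def mult.assoc)
    also have "\<dots> = e"
    proof -
      have "u j k * (e * (p j - p k)) = e"
        using j k by (simp add: u_inverse(1)[OF j k jk] mult.assoc[symmetric] u_unit(2)[OF j k jk])
      then show ?thesis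
        by (simp only: u_inverse(1)[OF i k ik] u_inverse(1)[OF i j ij]
            u_unit(2)[OF i j ij] mult.assoc[symmetric])
    qed
    finally show ?thesis .
  qed
  then have "\<epsilon> * \<epsilon> * (U * (- ((p i - p k) * ((p j - p k) * (p i - p j))))) = - (\<epsilon> * \<epsilon>)"
    by (simp add: mult.assoc)
  then show ?thesis
    unfolding prod vandermonde[symmetric] by (simp only: distrib_left)
qed

definition g :: "nat \<Rightarrow> 'a" where
  "g i = r i - a i (Suc i)"

lemma g_unit [simp]:
  assumes "i \<in> {1..<n}"
  shows "e * g i = g i" "g i * e = g i"
  using assms by (simp_all add: g_def algebra_simps)

text \<open>
  Here the choice of \<open>a\<close> pays off: the identities \<open>aP\<close> and \<open>aq\<close> in the proof say that the
  failure of \<open>a\<close> itself to satisfy the homogeneous rules is exactly the inhomogeneous term in the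
  rules for \<open>R\<^sub>i\<close>.
\<close>

lemma
  assumes i: "i \<in> {1..<n}" and j: "j \<in> {1..n}"
  shows g_p: "g i * p j = p (transpose i (Suc i) j) * g i"
    and g_q: "g i * q j = - (q (transpose i (Suc i) j) * g i)"
proof -
  have i': "i \<in> {1..n}" "Suc i \<in> {1..n}" "i \<noteq> Suc i" using i by auto
  consider "j = i" | "j = Suc i" | "j \<noteq> i" "j \<noteq> Suc i" by blast
  note cases = this
  let ?u = "u i (Suc i)" and ?P = "p i - p (Suc i)"
  note pq = p_q[OF i'(1,1)] p_q[OF i'(1,2)] p_q[OF i'(2,1)] p_q[OF i'(2,2)]
  have aP: "a i (Suc i) * ?P = \<epsilon> * (q i - q (Suc i))"
  proof -
    have "a i (Suc i) * ?P = \<epsilon> * (?u * ?P * (q i - q (Suc i)))"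
      by (simp add: a_def algebra_simps pq)
    also have "\<dots> = \<epsilon> * (q i - q (Suc i))"
      unfolding u_inverse[OF i'] using i' by (simp add: algebra_simps)
    finally show ?thesis .
  qed
  have aq: "a i (Suc i) * q i + q (Suc i) * a i (Suc i) = - (\<epsilon> * (p i + p (Suc i)))"
    "a i (Suc i) * q (Suc i) + q i * a i (Suc i) = - (\<epsilon> * (p i + p (Suc i)))"
  proof -
    have "\<epsilon> * (p i + p (Suc i)) = \<epsilon> * (?u * ?P * (p i + p (Suc i)))"
      unfolding u_inverse[OF i'] using i' by (simp add: algebra_simps)
    also have "\<dots> = \<epsilon> * (?u * (p i * p i - p (Suc i) * p (Suc i)))"
      by (simp add: algebra_simps p_p[OF i'(2,1)])
    finally have P: "\<epsilon> * (p i + p (Suc i)) = \<epsilon> * (?u * (p i * p i - p (Suc i) * p (Suc i)))" .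
    note rules = \<epsilon>_central(3)[OF i'(1)] \<epsilon>_central(3)[OF i'(2)]
      u_central(2)[OF i' i'(1)] u_central(2)[OF i' i'(2)]
      q_q[OF i'(2,1) i'(3)[symmetric]] q_sq[OF i'(1)] q_sq[OF i'(2)]
    show "a i (Suc i) * q i + q (Suc i) * a i (Suc i) = - (\<epsilon> * (p i + p (Suc i)))"
      "a i (Suc i) * q (Suc i) + q i * a i (Suc i) = - (\<epsilon> * (p i + p (Suc i)))"
      unfolding P by (simp_all add: a_def algebra_simps rules rules[THEN mult_assoc_rule])
  qed
  show "g i * p j = p (transpose i (Suc i) j) * g i"
    using cases
  proof cases
    case 1
    then show ?thesis
      using aP by (simp add: g_def algebra_simps r_p[OF i] p_a[OF i' i'(1)] p_a[OF i' i'(2)])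
  next
    case 2
    then show ?thesis
      using aP by (simp add: g_def algebra_simps r_p_Suc[OF i] p_a[OF i' i'(1)] p_a[OF i' i'(2)])
  next
    case 3
    then show ?thesis
      using i j by (simp add: g_def algebra_simps r_p_far[OF i] p_a[OF i' j])
  qed
  show "g i * q j = - (q (transpose i (Suc i) j) * g i)"
    using cases
  proof cases
    case 1
    then show ?thesis
      using aq by (simp add: g_def algebra_simps r_q[OF i])
  next
    case 2
    then show ?thesis
      using aq by (simp add: g_def algebra_simps r_q_Suc[OF i])
  next
    case 3
    have "a i (Suc i) * q j = - (q j * a i (Suc i))"
    proof -
      note rules = \<epsilon>_central(3)[OF j] u_central(2)[OF i' j] q_q[OF j i'(1) 3(1)] q_q[OF j i'(2) 3(2)]
      show ?thesis
        by (simp add: a_def algebra_simps rules rules[THEN mult_assoc_rule])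
    qed
    with 3 show ?thesis
      by (simp add: g_def algebra_simps r_q_far[OF i j])
  qed
qed

lemma g_a:
  assumes i: "i \<in> {1..<n}" and jk: "j \<in> {1..n}" "k \<in> {1..n}" "j \<noteq> k"
  shows "g i * a j k = - (a (transpose i (Suc i) j) (transpose i (Suc i) k) * g i)"
proof -
  let ?s = "transpose i (Suc i)"
  have s: "?s j \<in> {1..n}" "?s k \<in> {1..n}" "?s j \<noteq> ?s k"
    using i jk by (auto simp: transpose_def)
  have u: "g i * u j k = u (?s j) (?s k) * g i"
    using i jk s by (intro u_intertwine g_p) auto
  have \<epsilon>: "g i * \<epsilon> = \<epsilon> * g i"
  proof -
    have i': "i \<in> {1..n}" "Suc i \<in> {1..n}" "i \<noteq> Suc i" using i by auto
    note rules = \<epsilon>_central(1)[OF i] \<epsilon>_central(3)[OF i'(1)] \<epsilon>_central(3)[OF i'(2)] u_central(3)[OF i']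
    show ?thesis
      by (simp add: g_def a_def algebra_simps rules rules[THEN mult_assoc_rule])
  qed
  note rules = \<epsilon> u g_q[OF i jk(1)] g_q[OF i jk(2)]
  show ?thesis
    by (simp add: a_def algebra_simps rules rules[THEN mult_assoc_rule])
qed

text \<open>
  Exchanging \<open>j\<close> and \<open>k\<close> leaves \<open>a j k\<close> unchanged, so \<open>g i\<close> anticommutes with \<open>a i (Suc i)\<close>.
\<close>

lemma g_square:
  assumes i: "i \<in> {1..<n}"
  shows "g i * g i = - (\<epsilon> * \<epsilon>) - e - e - a i (Suc i) * a i (Suc i)"
proof -
  have "g i * a i (Suc i) = - (a i (Suc i) * g i)"
    using i g_a[OF i, of i "Suc i"] a_sym[of i "Suc i"] by simp
  moreover have "r i * r i = (g i + a i (Suc i)) * (g i + a i (Suc i))"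
    by (simp add: g_def)
  ultimately show ?thesis
    using r_sq[OF i] by (simp add: algebra_simps)
qed

lemma g_square_explicit:
  assumes i: "i \<in> {1..<n}"
  shows "g i * g i = - (e + e) +
    (\<epsilon> * \<epsilon> + \<epsilon> * \<epsilon>) * (u i (Suc i) * u i (Suc i) * (p i * p (Suc i) - e))"
proof -
  have i': "i \<in> {1..n}" "Suc i \<in> {1..n}" "i \<noteq> Suc i" using i by auto
  let ?u = "u i (Suc i)" and ?P = "p i - p (Suc i)"
  \<comment> \<open>Multiplying the scalar \<open>\<epsilon>\<^sup>2\<close> of \<open>r i * r i\<close> by \<open>?u\<^sup>2 ?P\<^sup>2 = e\<close> puts it over the denominator of \<open>a\<^sup>2\<close>.\<close>
  have "\<epsilon> * \<epsilon> = \<epsilon> * (\<epsilon> * (?u * (?u * ?P) * ?P))"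
    using i' by (simp add: u_inverse[OF i'])
  also have "\<dots> = \<epsilon> * \<epsilon> * (?u * ?u * (p i * p i + p (Suc i) * p (Suc i) - p i * p (Suc i) - p i * p (Suc i)))"
    by (simp add: algebra_simps p_p[OF i'(2,1)])
  finally have "\<epsilon> * \<epsilon> = \<dots>" .
  then show ?thesis
    unfolding g_square[OF i] a_square[OF i'] by (simp add: algebra_simps)
qed

lemma g_g_far:
  assumes i: "i \<in> {1..<n}" and j: "j \<in> {1..<n}" and far: "\<bar>int i - int j\<bar> > 1"
  shows "g i * g j = - (g j * g i)"
proof -
  let ?a = "a i (Suc i)" and ?b = "a j (Suc j)"
  have 1: "g i * ?b = - (?b * g i)"
    using far i j g_a[OF i, of j "Suc j"] by (auto simp: transpose_def)
  have 2: "g j * ?a = - (?a * g j)"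
    using far i j g_a[OF j, of i "Suc i"] by (auto simp: transpose_def)
  have "(g i + ?a) * (g j + ?b) = - ((g j + ?b) * (g i + ?a))"
    using r_r[OF i j far] by (simp add: g_def)
  moreover have "?a * ?b = - (?b * ?a)"
  proof -
    have m: "i \<in> {1..n}" "Suc i \<in> {1..n}" "i \<noteq> Suc i" "j \<in> {1..n}" "Suc j \<in> {1..n}" "j \<noteq> Suc j"
      and d: "i \<noteq> j" "i \<noteq> Suc j" "Suc i \<noteq> j" "Suc i \<noteq> Suc j"
      using i j far by auto
    note rules = q_q[OF m(1,4) d(1)] q_q[OF m(1,5) d(2)] q_q[OF m(2,4) d(3)] q_q[OF m(2,5) d(4)]
      u_central(4)[OF m]
    show ?thesis
      unfolding a_mult[OF m] a_mult[OF m(4-6) m(1-3)] u_central(4)[OF m]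
      by (simp add: algebra_simps rules rules[THEN mult_assoc_rule])
  qed
  ultimately show ?thesis
    using 1 2 by (simp add: algebra_simps eq_neg_iff_add_eq_0)
qed

lemma g_braid:
  assumes i: "i \<in> {1..<n}" "Suc i \<in> {1..<n}"
  shows "g i * g (Suc i) * g i = g (Suc i) * g i * g (Suc i)"
proof -
  define j k where "j = Suc i" and "k = Suc (Suc i)"
  have m: "i \<in> {1..n}" "j \<in> {1..n}" "k \<in> {1..n}" and d: "i \<noteq> j" "j \<noteq> k" "i \<noteq> k"
    using i by (auto simp: j_def k_def)
  note sym = a_sym[OF m(1,2) d(1)] a_sym[OF m(2,3) d(2)] a_sym[OF m(1,3) d(3)]
  have g_a': "g i * a i j = - (a i j * g i)" "g i * a j k = - (a i k * g i)" "g i * a i k = - (a j k * g i)"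
    "g j * a j k = - (a j k * g j)" "g j * a i j = - (a i k * g j)" "g j * a i k = - (a i j * g j)"
    using g_a[OF i(1) m(1,2) d(1)] g_a[OF i(1) m(2,3) d(2)] g_a[OF i(1) m(1,3) d(3)]
      g_a[OF i(2) m(1,2) d(1)] g_a[OF i(2) m(2,3) d(2)] g_a[OF i(2) m(1,3) d(3)] sym d
    by (simp_all add: j_def k_def transpose_def)
  show ?thesis
    unfolding j_def[symmetric]
  proof (rule braid_relation_of_shifted[where A = "a i j" and B = "a j k" and C = "a i k"
        and t = "\<epsilon> * \<epsilon>" and s = "- (\<epsilon> * \<epsilon>) - e - e"])
    show "g i * g i = - (\<epsilon> * \<epsilon>) - e - e - a i j * a i j"
      "g j * g j = - (\<epsilon> * \<epsilon>) - e - e - a j k * a j k"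
      using g_square[OF i(1)] g_square[OF i(2)] by (simp_all add: j_def k_def)
    show "a i k * a i j + a i j * a j k + a j k * a i k = - (\<epsilon> * \<epsilon>)"
      by (rule three_term[OF m d])
    show "a i j * a i k + a i k * a j k + a j k * a i j = - (\<epsilon> * \<epsilon>)"
      using three_term[OF m(3,2,1) d(2)[symmetric] d(1)[symmetric] d(3)[symmetric]] sym
      by (simp add: algebra_simps)
    show "\<epsilon> * \<epsilon> * a j k = a j k * (\<epsilon> * \<epsilon>)"
    proof -
      note rules = \<epsilon>_central(3)[OF m(2)] \<epsilon>_central(3)[OF m(3)] u_central(3)[OF m(2,3) d(2)]
      show ?thesis
        by (simp add: a_def algebra_simps rules rules[THEN mult_assoc_rule])
    qed
    show "a j k * a j k * a i k = a i k * (a j k * a j k)"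
      by (rule a_square_central[OF m(2,3) d(2) m(1,3) d(3)])
    show "(g i + a i j) * (g j + a j k) * (g i + a i j) - (g j + a j k) * (g i + a i j) * (g j + a j k)
        = \<epsilon> * \<epsilon> * (g j + a j k - (g i + a i j))"
      using r_braid[OF i] by (simp add: g_def j_def k_def)
  qed (fact g_a')+
qed

end

section \<open>The free algebra and the ground field\<close>

lemma scalF_hom:
  "scalF 1 = 1" "scalF (x + y) = scalF x + scalF y" "scalF (x * y) = scalF x * scalF y"
  "scalF (- x) = - scalF x" "scalF (x - y) = scalF x - scalF y"
  by (simp_all add: scalF_def single_add mult_single single_uminus single_diff)


text \<open>
  Multiplied by \<open>q\<^sup>2\<close>, the sum \<open>\<epsilon>\<^sup>2 + 2 = q\<^sup>2 + q\<^sup>-\<^sup>2\<close> becomes the nonzero polynomial \<open>q\<^sup>4 + 1\<close>.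
\<close>

lemma eps_sq_add_2_nonzero: "eps\<^sup>2 + 2 \<noteq> 0"
proof
  assume "eps\<^sup>2 + 2 = 0"
  moreover have q: "qpar \<noteq> 0"
    by (simp add: qpar_def Zero_fract_def eq_fract)
  ultimately have "qpar ^ 4 + 1 = 0"
    by (simp add: eps_def power2_eq_square field_simps numeral_eq_Suc)
  then have "Fract ([:0, 1:] ^ 4 + 1) 1 = (0 :: cq)"
    by (simp add: qpar_def One_fract_def numeral_eq_Suc)
  then have "[:0, 1:] ^ 4 + 1 = (0 :: complex poly)"
    by (simp add: Zero_fract_def eq_fract)
  then have "poly ([:0, 1:] ^ 4 + 1) 0 = (0 :: complex)"
    by simp
  then show False by simp
qed

lemma two_nonzero: "(2 :: cq) \<noteq> 0"
proof
  assume "(2 :: cq) = 0"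
  then have "Fract 1 1 + Fract 1 1 = (0 :: cq)" by (simp flip: One_fract_def)
  then show False by (simp add: Zero_fract_def eq_fract)
qed

lemma free_alg_induct [consumes 1, case_names scal gen add mult]:
  assumes f: "f \<in> carrier (free_alg n)"
    and scal: "\<And>c. P (scalF c)" and gen: "\<And>x. x \<in> gens n \<Longrightarrow> P (genF x)"
    and add: "\<And>x y. \<lbrakk>x \<in> carrier (free_alg n); y \<in> carrier (free_alg n); P x; P y\<rbrakk> \<Longrightarrow> P (x + y)"
    and mult: "\<And>x y. \<lbrakk>x \<in> carrier (free_alg n); y \<in> carrier (free_alg n); P x; P y\<rbrakk> \<Longrightarrow> P (x * y)"
  shows "P f"
proof -
  have word: "P (Poly_Mapping.single (Word ws) c)" if "set ws \<subseteq> gens n" for ws c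
    using that
  proof (induction ws)
    case Nil
    then show ?case using scal[of c] by (simp add: scalF_def zero_word_def)
  next
    case (Cons x ws)
    have "genF x * Poly_Mapping.single (Word ws) c = Poly_Mapping.single (Word (x # ws)) c"
      by (simp add: genF_def mult_single plus_word_def)
    with Cons mult[of "genF x" "Poly_Mapping.single (Word ws) c"] gen[of x] show ?case
      by (simp add: genF_closed) (simp add: free_alg_def)
  qed
  show ?thesis
    using f
  proof (induction "card (Poly_Mapping.keys f)" arbitrary: f)
    case 0
    then show ?case using scal[of 0] by (simp add: scalF_def)
  next
    case (Suc k)
    then obtain w where w: "w \<in> Poly_Mapping.keys f"
      by (metis card.empty ex_in_conv nat.distinct(1))
    define m where "m = Poly_Mapping.single w (Poly_Mapping.lookup f w)"
    have keys: "Poly_Mapping.keys (f - m) = Poly_Mapping.keys f - {w}"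
      by (auto simp: m_def in_keys_iff lookup_minus lookup_single when_def split: if_splits)
    have mP: "P m" "m \<in> carrier (free_alg n)"
      using word[of "letters w"] w Suc.prems by (auto simp: m_def free_alg_def)
    moreover have "P (f - m)" "f - m \<in> carrier (free_alg n)"
      using Suc mP w by (auto simp: keys intro!: Suc.hyps free_alg_closed)
    ultimately have "P (f - m + m)" by (intro add)
    then show ?case by simp
  qed
qed

lemma scalF_commute: "f \<in> carrier (free_alg n) \<Longrightarrow> scalF c * f = f * scalF c"
proof (induction rule: free_alg_induct)
  case (mult x y)
  then show ?case by (metis mult.assoc)
qed (simp_all add: scalF_def genF_def mult_single mult.commute algebra_simps)

lemma prod_list_closed:
  "\<forall>x\<in>set xs. x \<in> carrier (free_alg n) \<Longrightarrow> prod_list xs \<in> carrier (free_alg n)"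
  by (induction xs) (auto intro: free_alg_closed one_closed)

section \<open>Homomorphisms that respect the defining relations\<close>

lemma gens_closed [simp]:
  "i \<in> {1..<n} \<Longrightarrow> RF i \<in> carrier (free_alg n)"
  "j \<in> {1..n} \<Longrightarrow> pF j \<in> carrier (free_alg n)"
  "j \<in> {1..n} \<Longrightarrow> qF j \<in> carrier (free_alg n)"
  by (auto intro!: genF_closed simp: gens_def)

text \<open>
  A ring homomorphism out of the free algebra that respects the defining relations.  Both the
  quotient map to the Hecke algebra and its composition with the localization map are of this
  kind, so the abstract relations are verified for both at once.
\<close>

locale hecke_hom =
  fixes n :: nat and B :: "'b ring" and \<psi> :: "free \<Rightarrow> 'b"
  assumes B: "ring B"
    and hom: "\<psi> \<in> ring_hom (free_alg n) B"
    and respects: "hecke_rel n x y \<Longrightarrow> \<psi> x = \<psi> y"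
begin

definition \<phi> :: "free \<Rightarrow> 'b ring_family" where
  "\<phi> x = in_family B (\<psi> x)"

lemma \<psi>_closed [simp]: "x \<in> carrier (free_alg n) \<Longrightarrow> \<psi> x \<in> carrier B"
  using hom by (rule ring_hom_closed)

lemma \<psi>_add: "\<lbrakk>x \<in> carrier (free_alg n); y \<in> carrier (free_alg n)\<rbrakk> \<Longrightarrow> \<psi> (x + y) = \<psi> x \<oplus>\<^bsub>B\<^esub> \<psi> y"
  using ring_hom_add[OF hom, of x y] by (simp add: free_alg_def)

lemma \<psi>_mult: "\<lbrakk>x \<in> carrier (free_alg n); y \<in> carrier (free_alg n)\<rbrakk> \<Longrightarrow> \<psi> (x * y) = \<psi> x \<otimes>\<^bsub>B\<^esub> \<psi> y"
  using ring_hom_mult[OF hom, of x y] by (simp add: free_alg_def)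

lemma \<psi>_one: "\<psi> 1 = \<one>\<^bsub>B\<^esub>"
  using ring_hom_one[OF hom] by (simp add: free_alg_def)

lemma \<phi>_add: "\<lbrakk>x \<in> carrier (free_alg n); y \<in> carrier (free_alg n)\<rbrakk> \<Longrightarrow> \<phi> (x + y) = \<phi> x + \<phi> y"
  by (simp add: \<phi>_def \<psi>_add in_family_add[OF B])

lemma \<phi>_mult: "\<lbrakk>x \<in> carrier (free_alg n); y \<in> carrier (free_alg n)\<rbrakk> \<Longrightarrow> \<phi> (x * y) = \<phi> x * \<phi> y"
  by (simp add: \<phi>_def \<psi>_mult in_family_mult[OF B])

lemma \<phi>_diff:
  assumes "x \<in> carrier (free_alg n)" "y \<in> carrier (free_alg n)"
  shows "\<phi> (x - y) = \<phi> x - \<phi> y"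
  using \<phi>_add[of "x - y" y] assms by (simp add: free_alg_closed)

lemma \<phi>_uminus: "x \<in> carrier (free_alg n) \<Longrightarrow> \<phi> (- x) = - \<phi> x"
  using \<phi>_add[of x "- x"] \<phi>_diff[of 0 0] scalF_closed[of 0 n]
  by (simp add: free_alg_closed scalF_def eq_neg_iff_add_eq_0 add.commute)

lemmas \<phi>_hom = \<phi>_add \<phi>_mult \<phi>_diff \<phi>_uminus

lemma \<phi>_respects: "hecke_rel n x y \<Longrightarrow> \<phi> x = \<phi> y"
  by (simp add: \<phi>_def respects)

lemma \<phi>_one:
  assumes "x \<in> carrier (free_alg n)"
  shows "\<phi> 1 * \<phi> x = \<phi> x" "\<phi> x * \<phi> 1 = \<phi> x"
  using \<phi>_mult[of 1 x] \<phi>_mult[of x 1] assms by (simp_all add: one_closed)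

lemma \<phi>_scal_commute: "x \<in> carrier (free_alg n) \<Longrightarrow> \<phi> x * \<phi> (scalF c) = \<phi> (scalF c) * \<phi> x"
  using \<phi>_mult[of x "scalF c"] \<phi>_mult[of "scalF c" x] by (simp add: scalF_closed scalF_commute)

sublocale rel: spin_hecke_relations n "\<phi> 1" "\<phi> (scalF eps)" "\<phi> (scalF (inverse (2 * (eps\<^sup>2 + 2))))"
  "\<lambda>i. \<phi> (RF i)" "\<lambda>j. \<phi> (pF j)" "\<lambda>j. \<phi> (qF j)"
proof
  note closed = scalF_closed one_closed free_alg_closed gens_closed
  note simps = \<phi>_hom closed scalF_hom
  show "\<phi> 1 * \<phi> 1 = \<phi> 1" "\<phi> 1 * \<phi> (scalF eps) = \<phi> (scalF eps)" "\<phi> (scalF eps) * \<phi> 1 = \<phi> (scalF eps)"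
    by (simp_all add: \<phi>_one closed)
  show "\<phi> (scalF (inverse (2 * (eps\<^sup>2 + 2)))) * (\<phi> (scalF eps) * \<phi> (scalF eps) + \<phi> 1 + \<phi> 1) +
      \<phi> (scalF (inverse (2 * (eps\<^sup>2 + 2)))) * (\<phi> (scalF eps) * \<phi> (scalF eps) + \<phi> 1 + \<phi> 1) = \<phi> 1"
  proof -
    let ?k = "inverse (2 * (eps\<^sup>2 + 2))"
    have "k * (x * x + 1 + 1) + k * (x * x + 1 + 1) = k * (2 * (x\<^sup>2 + 2))" for k x :: cq
      by (simp add: power2_eq_square algebra_simps)
    then have "?k * (eps * eps + 1 + 1) + ?k * (eps * eps + 1 + 1) = ?k * (2 * (eps\<^sup>2 + 2))" .
    also have "\<dots> = 1" using eps_sq_add_2_nonzero two_nonzero by (metis left_inverse mult_eq_0_iff)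
    finally have "\<phi> (scalF (?k * (eps * eps + 1 + 1) + ?k * (eps * eps + 1 + 1))) = \<phi> 1"
      by (simp add: scalF_hom)
    then show ?thesis
      by (simp only: simps)
  qed
  fix i assume i: "i \<in> {1..<n}"
  then have i': "i \<in> {1..n}" "Suc i \<in> {1..n}" by auto
  show "\<phi> 1 * \<phi> (RF i) = \<phi> (RF i)" "\<phi> (RF i) * \<phi> 1 = \<phi> (RF i)"
    using i by (simp_all add: \<phi>_one)
  show "\<phi> (RF i) * \<phi> (scalF eps) = \<phi> (scalF eps) * \<phi> (RF i)"
    using i by (simp add: \<phi>_scal_commute)
  show "\<phi> (RF i) * \<phi> (RF i) = - (\<phi> (scalF eps) * \<phi> (scalF eps)) - \<phi> 1 - \<phi> 1"
  proof -
    have "\<phi> (scalF 2) = \<phi> 1 + \<phi> 1"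
      by (simp only: one_add_one[symmetric] simps)
    then show ?thesis
      using \<phi>_respects[OF R_sq[OF i]] i by (simp add: simps power2_eq_square)
  qed
  show "\<phi> (RF i) * \<phi> (pF i) = \<phi> (pF (Suc i)) * \<phi> (RF i) + \<phi> (scalF eps) * (\<phi> (qF i) - \<phi> (qF (Suc i)))"
    using \<phi>_respects[OF R_p[OF i]] i i' by (simp add: simps)
  show "\<phi> (RF i) * \<phi> (qF i) = - (\<phi> (qF (Suc i)) * \<phi> (RF i)) - \<phi> (scalF eps) * (\<phi> (pF i) + \<phi> (pF (Suc i)))"
    using \<phi>_respects[OF R_q[OF i]] i i' by (simp add: simps)
  show "\<phi> (RF i) * \<phi> (RF (Suc i)) * \<phi> (RF i) - \<phi> (RF (Suc i)) * \<phi> (RF i) * \<phi> (RF (Suc i)) =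
      \<phi> (scalF eps) * \<phi> (scalF eps) * (\<phi> (RF (Suc i)) - \<phi> (RF i))" if "Suc i \<in> {1..<n}"
    using \<phi>_respects[OF R_braid[OF i]] i that by (simp add: simps power2_eq_square)
  show "\<phi> (RF i) * \<phi> (RF j) = - (\<phi> (RF j) * \<phi> (RF i))"
    if "j \<in> {1..<n}" "\<bar>int i - int j\<bar> > 1" for j
    using \<phi>_respects[OF R_R[OF i that]] i that(1) by (simp add: simps)
  fix j assume j: "j \<in> {1..n}" "j \<noteq> i" "j \<noteq> Suc i"
  show "\<phi> (RF i) * \<phi> (pF j) = \<phi> (pF j) * \<phi> (RF i)"
    using \<phi>_respects[OF R_p_far[OF i j(1)]] i j by (simp add: simps)
  show "\<phi> (RF i) * \<phi> (qF j) = - (\<phi> (qF j) * \<phi> (RF i))"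
    using \<phi>_respects[OF R_q_far[OF i j(1)]] i j by (simp add: simps)
next
  note closed = scalF_closed one_closed free_alg_closed gens_closed
  note simps = \<phi>_hom closed
  fix j assume j: "j \<in> {1..n}"
  show "\<phi> 1 * \<phi> (pF j) = \<phi> (pF j)" "\<phi> (pF j) * \<phi> 1 = \<phi> (pF j)"
    "\<phi> 1 * \<phi> (qF j) = \<phi> (qF j)" "\<phi> (qF j) * \<phi> 1 = \<phi> (qF j)"
    using j by (simp_all add: \<phi>_one)
  show "\<phi> (pF j) * \<phi> (scalF eps) = \<phi> (scalF eps) * \<phi> (pF j)"
    "\<phi> (qF j) * \<phi> (scalF eps) = \<phi> (scalF eps) * \<phi> (qF j)"
    using j by (simp_all add: \<phi>_scal_commute)
  show "\<phi> (qF j) * \<phi> (qF j) = \<phi> 1 - \<phi> (pF j) * \<phi> (pF j)"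
    using \<phi>_respects[OF p_q_sq[OF j]] j by (simp add: simps algebra_simps)
  fix k assume k: "k \<in> {1..n}"
  show "\<phi> (pF j) * \<phi> (pF k) = \<phi> (pF k) * \<phi> (pF j)"
    using \<phi>_respects[OF p_p[OF j k]] j k by (cases "j = k") (simp_all add: simps)
  show "\<phi> (pF j) * \<phi> (qF k) = \<phi> (qF k) * \<phi> (pF j)"
    using \<phi>_respects[OF p_q[OF j k]] j k by (simp add: simps)
  show "\<phi> (qF j) * \<phi> (qF k) = - (\<phi> (qF k) * \<phi> (qF j))" if "j \<noteq> k"
    using \<phi>_respects[OF q_q[OF j k that]] j k by (simp add: simps)
qed

lemma \<phi>_prod_list:
  "\<forall>x\<in>set xs. x \<in> carrier (free_alg n) \<Longrightarrow> \<phi> (prod_list xs) = rel.ordered_prod (map \<phi> xs)"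
  by (induction xs) (auto simp: \<phi>_mult prod_list_closed)

lemma \<phi>_discriminant:
  "\<phi> (prod_list [(pF i - pF j)\<^sup>2. i \<leftarrow> [1..<n+1], j \<leftarrow> [i+1..<n+1]]) = rel.discriminant"
proof -
  let ?L = "[(pF i - pF j)\<^sup>2. i \<leftarrow> [1..<n+1], j \<leftarrow> [i+1..<n+1]]"
  have closed: "(pF i - pF j)\<^sup>2 \<in> carrier (free_alg n)" if "i \<in> {1..n}" "j \<in> {1..n}" for i j
    unfolding power2_eq_square using that by (intro free_alg_closed gens_closed)
  have "\<phi> ((pF i - pF j)\<^sup>2) = rel.sq_diff i j" if "i \<in> {1..n}" "j \<in> {1..n}" for i j
    using that by (simp add: rel.sq_diff_def power2_eq_square \<phi>_hom free_alg_closed)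
  then have "map \<phi> ?L = [rel.sq_diff i j. i \<leftarrow> [1..<Suc n], j \<leftarrow> [Suc i..<Suc n]]"
    unfolding map_concat map_map comp_def Suc_eq_plus1
    by (intro arg_cong[where f = concat] map_cong refl) (simp del: upt_Suc)
  moreover have "\<phi> (prod_list ?L) = rel.ordered_prod (map \<phi> ?L)"
    by (intro \<phi>_prod_list) (auto intro!: closed simp del: upt_Suc)
  ultimately show ?thesis
    by (simp only: rel.discriminant_def)
qed

text \<open>
  Only the generators \<open>R\<^sub>i\<close> need an argument; the discriminant is a polynomial in the \<open>p\<close>, with
  which the scalars, the \<open>p\<close> and the \<open>q\<close> commute.
\<close>

lemma discriminant_central:
  assumes "f \<in> carrier (free_alg n)"
  shows "\<phi> f * rel.discriminant = rel.discriminant * \<phi> f"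
  using assms
proof (induction rule: free_alg_induct)
  case (scal c)
  show ?case
    by (intro rel.discriminant_commute)
       (simp_all add: \<phi>_one \<phi>_scal_commute scalF_closed)
next
  case (gen x)
  then consider i where "i \<in> {1..<n}" "x = GR i" | j where "j \<in> {1..n}" "x = GP j"
    | j where "j \<in> {1..n}" "x = GQ j" by (auto simp: gens_def)
  then show ?case
  proof cases
    case 1
    then show ?thesis by (simp add: rel.r_discriminant)
  next
    case 2
    then show ?thesis by (auto intro!: rel.discriminant_commute rel.p_p simp: \<phi>_one)
  next
    case 3
    then show ?thesis by (auto intro!: rel.discriminant_commute rel.p_q[symmetric] simp: \<phi>_one)
  qed
next
  case (add x y)
  then show ?case by (simp add: \<phi>_add algebra_simps)
next
  case (mult x y)
  then show ?case
    using commute_mult[of rel.discriminant "\<phi> x" "\<phi> y"] by (simp add: \<phi>_mult)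
qed

end


section \<open>The Hecke algebra and its localization\<close>

lemma hecke_class_hom: "hecke_class n \<in> ring_hom (free_alg n) (spin_hecke n)"
  using ideal.rcos_ring_hom[OF hecke_ideal_ideal[of n]]
  by (simp add: hecke_class_def[abs_def] spin_hecke_def)

lemma free_alg_minus:
  assumes "x \<in> carrier (free_alg n)" "y \<in> carrier (free_alg n)"
  shows "x \<ominus>\<^bsub>free_alg n\<^esub> y = x - y"
proof -
  interpret F: ring "free_alg n" by (rule free_alg_ring)
  have "\<ominus>\<^bsub>free_alg n\<^esub> y = - y"
    using assms free_alg_closed(3)[OF assms(2)] by (intro F.minus_equality) (simp_all add: free_alg_def)
  then show ?thesis by (simp add: a_minus_def) (simp add: free_alg_def)
qed

lemma hecke_rel_carrier:
  "hecke_rel n x y \<Longrightarrow> x \<in> carrier (free_alg n) \<and> y \<in> carrier (free_alg n)"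
proof (induction rule: hecke_rel.induct)
qed (intro conjI free_alg_closed gens_closed scalF_closed one_closed; auto)+

lemma hecke_class_respects:
  assumes "hecke_rel n x y"
  shows "hecke_class n x = hecke_class n y"
proof -
  interpret F: ring "free_alg n" by (rule free_alg_ring)
  have "x - y \<in> hecke_ideal n"
    unfolding hecke_ideal_def
    using assms by (intro set_mp[OF F.genideal_self]) (auto intro: hecke_rel_closed)
  then show ?thesis
    using hecke_rel_carrier[OF assms] F.quotient_eq_iff_same_a_r_cos[OF hecke_ideal_ideal, of x y]
    by (simp add: hecke_class_def free_alg_minus)
qed

lemma hecke_hom_class: "hecke_hom n (spin_hecke n) (hecke_class n)"
  by (rule hecke_hom.intro) (fact spin_hecke_ring hecke_class_hom hecke_class_respects)+

lemma hecke_delta_central: "central_element (spin_hecke n) (hecke_delta n)"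
proof -
  interpret hecke_hom n "spin_hecke n" "hecke_class n" by (rule hecke_hom_class)
  interpret A: ring "spin_hecke n" by (rule spin_hecke_ring)
  have D: "rel.discriminant = in_family (spin_hecke n) (hecke_delta n)"
    unfolding \<phi>_discriminant[symmetric] unfolding \<phi>_def hecke_delta_def ..
  have closed: "hecke_delta n \<in> carrier (spin_hecke n)"
    unfolding hecke_delta_def power2_eq_square
    by (intro \<psi>_closed prod_list_closed)
       (auto intro!: free_alg_closed gens_closed simp del: upt_Suc)
  show ?thesis
  proof (unfold_locales, fact closed)
    fix x assume "x \<in> carrier (spin_hecke n)"
    then obtain f where f: "f \<in> carrier (free_alg n)" "x = hecke_class n f"
      by (auto simp: spin_hecke_def FactRing_def A_RCOSETS_def' hecke_class_def)
    have x: "x \<in> carrier (spin_hecke n)" using f by simp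
    have "\<phi> f * in_family (spin_hecke n) (hecke_delta n) = in_family (spin_hecke n) (hecke_delta n) * \<phi> f"
      using discriminant_central[OF f(1)] unfolding D .
    then have "in_family (spin_hecke n) (x \<otimes>\<^bsub>spin_hecke n\<^esub> hecke_delta n)
        = in_family (spin_hecke n) (hecke_delta n \<otimes>\<^bsub>spin_hecke n\<^esub> x)"
      using f(2) x closed by (simp add: \<phi>_def in_family_mult[OF B])
    then show "x \<otimes>\<^bsub>spin_hecke n\<^esub> hecke_delta n = hecke_delta n \<otimes>\<^bsub>spin_hecke n\<^esub> x"
      using x closed by (simp add: in_family_inject[OF B])
  qed
qed

lemma hecke_loc_ring: "ring (hecke_loc n)"
  unfolding hecke_loc_def by (rule central_element.loc_ring[OF hecke_delta_central])

lemma to_loc_hom: "to_loc n \<in> ring_hom (free_alg n) (hecke_loc n)"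
  using ring_hom_trans[OF hecke_class_hom central_element.fraction_hom[OF hecke_delta_central]]
  by (simp add: to_loc_def[abs_def] hecke_loc_def comp_def)

lemma hecke_hom_to_loc: "hecke_hom n (hecke_loc n) (to_loc n)"
  by (rule hecke_hom.intro)
     (auto simp: to_loc_def hecke_class_respects hecke_loc_ring intro: to_loc_hom)

text \<open>
  A factor of a unit of a noncommutative monoid need not be a unit.  It is one if it commutes
  with the cofactors on both sides, for then it is both a left and a right factor.
\<close>

lemma (in monoid) Units_of_central_multiple:
  assumes d: "d \<in> Units G" and closed: "P \<in> carrier G" "Y \<in> carrier G" "Z \<in> carrier G"
    and fact: "d = Y \<otimes> ((P \<otimes> P) \<otimes> Z)" and comm: "P \<otimes> Y = Y \<otimes> P" "P \<otimes> Z = Z \<otimes> P"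
  shows "P \<in> Units G"
proof -
  obtain W where Wc: "W \<in> carrier G" and l: "P \<otimes> W = d" and r: "W \<otimes> P = d"
  proof
    show "Y \<otimes> (P \<otimes> Z) \<in> carrier G" using closed by simp
    have "P \<otimes> (Y \<otimes> (P \<otimes> Z)) = (P \<otimes> Y) \<otimes> (P \<otimes> Z)" using closed by (simp add: m_assoc)
    also have "\<dots> = d" unfolding comm(1) fact using closed by (simp add: m_assoc)
    finally show "P \<otimes> (Y \<otimes> (P \<otimes> Z)) = d" .
    have "(Y \<otimes> (P \<otimes> Z)) \<otimes> P = Y \<otimes> (P \<otimes> (Z \<otimes> P))" using closed by (simp add: m_assoc)
    also have "\<dots> = d" unfolding comm(2)[symmetric] fact using closed by (simp add: m_assoc)
    finally show "(Y \<otimes> (P \<otimes> Z)) \<otimes> P = d" .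
  qed
  have inv: "inv d \<in> carrier G" "d \<otimes> inv d = \<one>" "inv d \<otimes> d = \<one>"
    using d by (rule Units_inv_closed Units_r_inv Units_l_inv)+
  have 1: "P \<otimes> (W \<otimes> inv d) = \<one>"
    by (simp only: m_assoc[OF closed(1) Wc inv(1), symmetric] l inv)
  have 2: "(inv d \<otimes> W) \<otimes> P = \<one>"
    by (simp only: m_assoc[OF inv(1) Wc closed(1)] r inv)
  have c: "W \<otimes> inv d \<in> carrier G" "inv d \<otimes> W \<in> carrier G" by (intro m_closed Wc inv)+
  have "inv d \<otimes> W = W \<otimes> inv d"
    by (rule inv_unique[OF 2 1 closed(1) c(2,1)])
  with 1 2 c closed(1) show ?thesis
    unfolding Units_def by auto
qed

text \<open>
  The element \<open>\<delta>\<close> is a unit of the localization and has \<open>p\<^sub>j - p\<^sub>k\<close> as a factor.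
\<close>

lemma p_diff_unit_less:
  assumes j: "j \<in> {1..n}" and k: "k \<in> {1..n}" and jk: "j < k"
  shows "p_loc n j \<ominus>\<^bsub>hecke_loc n\<^esub> p_loc n k \<in> Units (hecke_loc n)"
proof -
  interpret hecke_hom n "hecke_loc n" "to_loc n" by (rule hecke_hom_to_loc)
  interpret C: central_element "spin_hecke n" "hecke_delta n" by (rule hecke_delta_central)
  interpret L: ring "hecke_loc n" by (rule hecke_loc_ring)
  define xs where "xs = [(pF i - pF j)\<^sup>2. i \<leftarrow> [1..<n+1], j \<leftarrow> [i+1..<n+1]]"
  let ?P = "to_loc n (pF j - pF k)"
  have xs_props: "x \<in> carrier (free_alg n)" "\<phi> x * \<phi> (pF j - pF k) = \<phi> (pF j - pF k) * \<phi> x"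
    if "x \<in> set xs" for x
  proof -
    have "\<exists>a\<in>{1..n}. \<exists>b\<in>{1..n}. x = (pF a - pF b)\<^sup>2"
    proof -
      have "\<exists>a\<in>{1..<n+1}. \<exists>b\<in>{a+1..<n+1}. x = (pF a - pF b)\<^sup>2"
        using that by (simp only: xs_def set_concat set_map set_upt image_image UN_iff image_iff)
      then show ?thesis by fastforce
    qed
    then obtain a b where ab: "a \<in> {1..n}" "b \<in> {1..n}" "x = (pF a - pF b)\<^sup>2" by blast
    then show x: "x \<in> carrier (free_alg n)"
      by (simp add: power2_eq_square free_alg_closed)
    have "rel.sq_diff a b * (\<phi> (pF j) - \<phi> (pF k)) = (\<phi> (pF j) - \<phi> (pF k)) * rel.sq_diff a b"
      by (intro rel.commute_sq_diff[symmetric])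
         (simp_all only: left_diff_distrib right_diff_distrib rel.p_p[OF j ab(1)]
           rel.p_p[OF k ab(1)] rel.p_p[OF j ab(2)] rel.p_p[OF k ab(2)])
    moreover have "\<phi> x = rel.sq_diff a b"
      using ab by (simp add: rel.sq_diff_def power2_eq_square \<phi>_hom free_alg_closed)
    ultimately show "\<phi> x * \<phi> (pF j - pF k) = \<phi> (pF j - pF k) * \<phi> x"
      using j k by (simp add: \<phi>_hom)
  qed
  have comm: "?P \<otimes>\<^bsub>hecke_loc n\<^esub> to_loc n (prod_list ys) = to_loc n (prod_list ys) \<otimes>\<^bsub>hecke_loc n\<^esub> ?P"
    if ys: "set ys \<subseteq> set xs" for ys
  proof -
    have closed: "prod_list ys \<in> carrier (free_alg n)"
      using xs_props ys by (intro prod_list_closed) auto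
    have P: "pF j - pF k \<in> carrier (free_alg n)"
      using j k by (simp add: free_alg_closed)
    have "\<phi> (pF j - pF k) * rel.ordered_prod (map \<phi> ys) = rel.ordered_prod (map \<phi> ys) * \<phi> (pF j - pF k)"
    proof (rule rel.commute_ordered_prod)
      show "\<forall>x\<in>set (map \<phi> ys). \<phi> (pF j - pF k) * x = x * \<phi> (pF j - pF k)"
        using xs_props(2) ys by auto
    qed (simp add: \<phi>_one P)
    then have "\<phi> (pF j - pF k) * \<phi> (prod_list ys) = \<phi> (prod_list ys) * \<phi> (pF j - pF k)"
      using xs_props ys by (subst (1 2) \<phi>_prod_list) auto
    then show ?thesis
      using closed P by (simp add: \<phi>_def in_family_inject[OF B] flip: in_family_mult[OF B])
  qed
  have "(pF j - pF k)\<^sup>2 \<in> set xs"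
    using j k jk by (auto simp: xs_def simp del: upt_Suc intro!: bexI[of _ j] imageI)
  then obtain ys zs where split: "xs = ys @ (pF j - pF k)\<^sup>2 # zs"
    by (meson split_list)
  then have sub: "set ys \<subseteq> set xs" "set zs \<subseteq> set xs" by auto
  have closed: "prod_list ys \<in> carrier (free_alg n)" "prod_list zs \<in> carrier (free_alg n)"
    "pF j - pF k \<in> carrier (free_alg n)"
    using xs_props sub j k by (auto intro!: prod_list_closed free_alg_closed gens_closed)
  have "to_loc n (prod_list xs) \<in> Units (hecke_loc n)"
  proof -
    have "to_loc n (prod_list xs) = fraction (spin_hecke n) (hecke_delta n) (hecke_delta n) 0"
      by (simp only: to_loc_def hecke_delta_def xs_def)
    moreover have "fraction (spin_hecke n) (hecke_delta n) (hecke_delta n) 0 \<in> carrier (hecke_loc n)"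
      "fraction (spin_hecke n) (hecke_delta n) \<one>\<^bsub>spin_hecke n\<^esub> 1 \<in> carrier (hecke_loc n)"
      unfolding hecke_loc_def C.carrier_loc by blast+
    ultimately show ?thesis
      using C.d_inverse by (auto simp: Units_def hecke_loc_def)
  qed
  moreover have "to_loc n (prod_list xs) = to_loc n (prod_list ys) \<otimes>\<^bsub>hecke_loc n\<^esub>
      ((?P \<otimes>\<^bsub>hecke_loc n\<^esub> ?P) \<otimes>\<^bsub>hecke_loc n\<^esub> to_loc n (prod_list zs))"
    unfolding split power2_eq_square using closed
    by (simp add: \<psi>_mult free_alg_closed)
  ultimately have "?P \<in> Units (hecke_loc n)"
    using closed by (intro L.Units_of_central_multiple[OF _ _ _ _ _ comm[OF sub(1)] comm[OF sub(2)]]) auto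
  moreover have "?P = p_loc n j \<ominus>\<^bsub>hecke_loc n\<^esub> p_loc n k"
  proof -
    have "\<phi> (pF j - pF k) = in_family (hecke_loc n) (p_loc n j \<ominus>\<^bsub>hecke_loc n\<^esub> p_loc n k)"
      using j k by (simp add: \<phi>_hom in_family_minus[OF B]) (simp add: \<phi>_def)
    then show ?thesis
      using j k closed(3) by (simp add: \<phi>_def in_family_inject[OF B])
  qed
  ultimately show ?thesis by simp
qed

lemma p_diff_unit:
  assumes j: "j \<in> {1..n}" and k: "k \<in> {1..n}" and jk: "j \<noteq> k"
  shows "p_loc n j \<ominus>\<^bsub>hecke_loc n\<^esub> p_loc n k \<in> Units (hecke_loc n)"
proof (cases "j < k")
  case False
  interpret hecke_hom n "hecke_loc n" "to_loc n" by (rule hecke_hom_to_loc)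
  interpret L: ring "hecke_loc n" by (rule hecke_loc_ring)
  have "p_loc n j \<ominus>\<^bsub>hecke_loc n\<^esub> p_loc n k = \<ominus>\<^bsub>hecke_loc n\<^esub> (p_loc n k \<ominus>\<^bsub>hecke_loc n\<^esub> p_loc n j)"
    using j k by (simp add: L.minus_eq L.minus_add L.a_comm)
  with False p_diff_unit_less[OF k j] jk show ?thesis
    using L.Units_m_closed[OF L.Units_minus_one_closed p_diff_unit_less[OF k j]] j k
    by (simp add: L.l_minus)
qed (use p_diff_unit_less[OF j k] in blast)

section \<open>The relations between the intertwiners\<close>

theorem proposition5p8:
  fixes n :: nat
    and L (structure)
    and p q g :: "nat \<Rightarrow> loc_elt"
    and c :: "cq \<Rightarrow> loc_elt"
  assumes n: "n \<ge> 2"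
  defines "L \<equiv> hecke_loc n"
    and "p \<equiv> p_loc n"
    and "q \<equiv> q_loc n"
    and "g \<equiv> gimel n"
    and "c \<equiv> scal_loc n"
  shows
    "(\<forall>i\<in>{1..<n}.
        g i [^] (2::nat) = c (- 2) \<oplus>
          c (2 * eps\<^sup>2) \<otimes> ((inv (p i \<ominus> p (i+1)) [^] (2::nat)) \<otimes> (p i \<otimes> p (i+1) \<ominus> \<one>)))
   \<and> (\<forall>i. i \<in> {1..<n} \<and> i + 1 \<in> {1..<n} \<longrightarrow>
        g i \<otimes> g (i+1) \<otimes> g i = g (i+1) \<otimes> g i \<otimes> g (i+1))
   \<and> (\<forall>i\<in>{1..<n}. \<forall>j\<in>{1..<n}. \<bar>int i - int j\<bar> > 1 \<longrightarrow>
        g i \<otimes> g j = \<ominus> (g j \<otimes> g i))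
   \<and> (\<forall>i\<in>{1..<n}. g i \<otimes> p i = p (i+1) \<otimes> g i \<and> g i \<otimes> p (i+1) = p i \<otimes> g i)
   \<and> (\<forall>i\<in>{1..<n}. \<forall>j\<in>{1..n}. j \<noteq> i \<and> j \<noteq> i + 1 \<longrightarrow>
        g i \<otimes> p j = p j \<otimes> g i \<and> g i \<otimes> q j = \<ominus> (q j \<otimes> g i))
   \<and> (\<forall>i\<in>{1..<n}.
        g i \<otimes> q i = \<ominus> (q (i+1) \<otimes> g i) \<and> g i \<otimes> q (i+1) = \<ominus> (q i \<otimes> g i))"
proof -
  have ring: "ring L" unfolding L_def by (rule hecke_loc_ring)
  interpret H: hecke_hom n L "to_loc n" unfolding L_def by (rule hecke_hom_to_loc)
  interpret L: ring L by (rule ring)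
  define \<iota> where "\<iota> = in_family L"
  note \<iota>_hom = in_family_add[OF ring, folded \<iota>_def] in_family_mult[OF ring, folded \<iota>_def]
    in_family_uminus[OF ring, folded \<iota>_def] in_family_minus[OF ring, folded \<iota>_def]
  note \<iota>_inject = in_family_inject[OF ring, folded \<iota>_def]
  have \<phi>: "H.\<phi> x = \<iota> (to_loc n x)" for x by (simp add: H.\<phi>_def \<iota>_def)
  have p: "p j \<in> carrier L" and q: "q j \<in> carrier L" if "j \<in> {1..n}" for j
    using that by (simp_all add: p_def q_def)
  have R: "R_loc n i \<in> carrier L" if "i \<in> {1..<n}" for i using that by simp
  have c: "c x \<in> carrier L" for x by (simp add: c_def scalF_closed)
  have unit: "p j \<ominus> p k \<in> Units L" if "j \<in> {1..n}" "k \<in> {1..n}" "j \<noteq> k" for j k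
    using p_diff_unit[OF that] by (simp add: L_def p_def)
  define u where "u j k = \<iota> (inv (p j \<ominus> p k))" for j k
  interpret S: localized_spin_hecke_relations n "H.\<phi> 1" "H.\<phi> (scalF eps)"
    "H.\<phi> (scalF (inverse (2 * (eps\<^sup>2 + 2))))"
    "\<lambda>i. H.\<phi> (RF i)" "\<lambda>j. H.\<phi> (pF j)" "\<lambda>j. H.\<phi> (qF j)" u
  proof
    fix j k assume jk: "j \<in> {1..n}" "k \<in> {1..n}" "j \<noteq> k"
    have one: "H.\<phi> 1 = \<iota> \<one>" by (simp add: \<phi> H.\<psi>_one)
    have diff: "H.\<phi> (pF j) - H.\<phi> (pF k) = \<iota> (p j \<ominus> p k)"
      using p[OF jk(1)] p[OF jk(2)] by (simp add: \<phi> \<iota>_hom p_def)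
    have closed: "p j \<ominus> p k \<in> carrier L" "inv (p j \<ominus> p k) \<in> carrier L"
      using unit[OF jk] by (auto intro: L.Units_closed)
    show "u j k * (H.\<phi> (pF j) - H.\<phi> (pF k)) = H.\<phi> 1" "(H.\<phi> (pF j) - H.\<phi> (pF k)) * u j k = H.\<phi> 1"
      unfolding diff one u_def \<iota>_hom(2)[OF closed, symmetric] \<iota>_hom(2)[OF closed(2,1), symmetric]
      using unit[OF jk] by simp_all
    show "H.\<phi> 1 * u j k = u j k" "u j k * H.\<phi> 1 = u j k"
      using closed(2) by (simp_all add: one u_def flip: \<iota>_hom)
  qed
  have g: "g i \<in> carrier L" "S.g i = \<iota> (g i)" if i: "i \<in> {1..<n}" for i
  proof -
    have i': "i \<in> {1..n}" "Suc i \<in> {1..n}" "i \<noteq> Suc i" using i by auto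
    note closed = R[OF i] c[of eps] L.Units_inv_closed[OF unit[OF i']] p[OF i'(1)] p[OF i'(2)]
      q[OF i'(1)] q[OF i'(2)]
    have g_eq: "g i = R_loc n i \<ominus> c eps \<otimes> (inv (p i \<ominus> p (Suc i)) \<otimes> (q i \<ominus> q (Suc i)))"
      by (simp add: g_def gimel_def L_def c_def p_def q_def)
    show "g i \<in> carrier L"
      using closed by (simp add: g_eq)
    show "S.g i = \<iota> (g i)"
      unfolding g_eq S.g_def S.a_def using closed
      by (simp add: \<phi> u_def \<iota>_hom) (simp add: c_def q_def)
  qed
  have p\<phi>: "H.\<phi> (pF j) = \<iota> (p j)" and q\<phi>: "H.\<phi> (qF j) = \<iota> (q j)" for j
    by (simp_all add: \<phi> p_def q_def)
  note transfer = p\<phi> q\<phi> g(1) p q \<iota>_inject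
  \<comment> \<open>The relations between the embedded elements are pulled back along the injective map \<open>\<iota>\<close>.\<close>
  have square: "g i [^] (2::nat) = c (- 2) \<oplus>
      c (2 * eps\<^sup>2) \<otimes> ((inv (p i \<ominus> p (i+1)) [^] (2::nat)) \<otimes> (p i \<otimes> p (i+1) \<ominus> \<one>))"
    if i: "i \<in> {1..<n}" for i
  proof -
    have i': "i \<in> {1..n}" "Suc i \<in> {1..n}" "i \<noteq> Suc i" using i by auto
    have closed: "inv (p i \<ominus> p (Suc i)) \<in> carrier L"
      using unit[OF i'] by simp
    have c2: "H.\<phi> (scalF (- 2)) = - (H.\<phi> 1 + H.\<phi> 1)"
      "H.\<phi> (scalF (2 * eps\<^sup>2)) = H.\<phi> (scalF eps) * H.\<phi> (scalF eps) + H.\<phi> (scalF eps) * H.\<phi> (scalF eps)"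
    proof -
      have "- 2 = - (1 + 1 :: cq)" "2 * eps\<^sup>2 = eps * eps + eps * eps"
        by (simp_all add: power2_eq_square)
      then show "H.\<phi> (scalF (- 2)) = - (H.\<phi> 1 + H.\<phi> 1)"
        "H.\<phi> (scalF (2 * eps\<^sup>2)) = H.\<phi> (scalF eps) * H.\<phi> (scalF eps) + H.\<phi> (scalF eps) * H.\<phi> (scalF eps)"
        by (simp_all only: scalF_hom H.\<phi>_hom scalF_closed one_closed free_alg_closed)
    qed
    have "\<iota> (g i \<otimes> g i) = \<iota> (c (- 2) \<oplus> c (2 * eps\<^sup>2) \<otimes>
        ((inv (p i \<ominus> p (Suc i)) \<otimes> inv (p i \<ominus> p (Suc i))) \<otimes> (p i \<otimes> p (Suc i) \<ominus> \<one>)))"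
    proof -
      have "\<iota> (c x) = H.\<phi> (scalF x)" for x by (simp add: \<phi> c_def)
      moreover have "\<iota> \<one> = H.\<phi> 1" by (simp add: \<phi> H.\<psi>_one)
      ultimately show ?thesis
        using S.g_square_explicit[OF i] i' closed c i unfolding g(2)[OF i]
        by (simp add: p\<phi> c2 u_def \<iota>_hom g(1) p)
    qed
    then show ?thesis
      using closed c i i' by (simp add: \<iota>_inject g(1) p numeral_2_eq_2)
  qed
  have braid: "g i \<otimes> g (i+1) \<otimes> g i = g (i+1) \<otimes> g i \<otimes> g (i+1)"
    if i: "i \<in> {1..<n}" "i + 1 \<in> {1..<n}" for i
    using S.g_braid[of i] i unfolding Suc_eq_plus1 g(2)[OF i(1)] g(2)[OF i(2)] by (simp add: transfer flip: \<iota>_hom)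
  have far: "g i \<otimes> g j = \<ominus> (g j \<otimes> g i)"
    if "i \<in> {1..<n}" "j \<in> {1..<n}" "\<bar>int i - int j\<bar> > 1" for i j
    using S.g_g_far[OF that] that(1,2) unfolding g(2)[OF that(1)] g(2)[OF that(2)] by (simp add: transfer flip: \<iota>_hom)
  have gp: "g i \<otimes> p j = p (transpose i (Suc i) j) \<otimes> g i"
    and gq: "g i \<otimes> q j = \<ominus> (q (transpose i (Suc i) j) \<otimes> g i)"
    if i: "i \<in> {1..<n}" and j: "j \<in> {1..n}" for i j
  proof -
    have s: "transpose i (Suc i) j \<in> {1..n}" using i j by (auto simp: transpose_def)
    show "g i \<otimes> p j = p (transpose i (Suc i) j) \<otimes> g i"
      using S.g_p[OF i j] i j s unfolding g(2)[OF i] by (simp add: transfer flip: \<iota>_hom)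
    show "g i \<otimes> q j = \<ominus> (q (transpose i (Suc i) j) \<otimes> g i)"
      using S.g_q[OF i j] i j s unfolding g(2)[OF i] by (simp add: transfer flip: \<iota>_hom)
  qed
  show ?thesis
  proof (intro conjI ballI allI impI; (elim conjE)?)
    fix i assume i: "i \<in> {1..<n}"
    then have i': "i \<in> {1..n}" "i + 1 \<in> {1..n}" by auto
    show "g i \<otimes> p i = p (i+1) \<otimes> g i" "g i \<otimes> p (i+1) = p i \<otimes> g i"
      "g i \<otimes> q i = \<ominus> (q (i+1) \<otimes> g i)" "g i \<otimes> q (i+1) = \<ominus> (q i \<otimes> g i)"
      using gp[OF i i'(1)] gp[OF i i'(2)] gq[OF i i'(1)] gq[OF i i'(2)] by simp_all
    fix j assume "j \<in> {1..n}" "j \<noteq> i" "j \<noteq> i + 1"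
    then show "g i \<otimes> p j = p j \<otimes> g i" "g i \<otimes> q j = \<ominus> (q j \<otimes> g i)"
      using gp[OF i, of j] gq[OF i, of j] by simp_all
  qed (fact square braid far)+
qed

end
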